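(* Let $d\ge 3$, let $a_1,\dots,a_d$ be integers, not all zero, and let $S_{d-1}=\{\mathbf{x}=(x_1,\dots,x_d)\in\mathbb{Z}^d:\ a_1x_1+\cdots+a_dx_d=0\}$. Then, for the simple symmetric random walk on $\mathbb{Z}^d$ started at the origin, $$\lim_{n\to\infty}\frac{\xi^{(d)}_{S_{d-1}}(n)}{\log n}=\frac{\lambda_d}{2}\qquad\text{almost surely}.$$
   Context: The simple symmetric random walk on $\mathbb{Z}^d$ is $\mathbf{S}_0=\mathbf{0}$, $\mathbf{S}_n=\sum_{k=1}^n\mathbf{X}_k$, where $\mathbf{X}_1,\mathbf{X}_2,\dots$ are i.i.d. with $\mathbf{P}(\mathbf{X}_1=\mathbf{e}_i)=\mathbf{P}(\mathbf{X}_1=-\mathbf{e}_i)=\frac1{2d}$ for $i=1,\dots,d$, and $\mathbf{e}_1,\dots,\mathbf{e}_d$ are the standard unit vectors of $\mathbb{Z}^d$. Its local time at $\mathbf{x}\in\mathbb{Z}^d$ is $\xi^{(d)}(\mathbf{x},n)=\#\{k:\ 0<k\le n,\ \mathbf{S}_k=\mathbf{x}\}$. For $A\subseteq\mathbb{Z}^d$, $\xi^{(d)}_A(n)=\max_{\mathbf{x}\in A}\xi^{(d)}(\mathbf{x},n)$. For $d\ge3$, $\gamma_d=\mathbf{P}(\mathbf{S}_k\ne\mathbf{0}\text{ for all }k\ge1)$ is the probability that the walk never returns to its starting point ($0<\gamma_d<1$), and $\lambda_d=-\dfrac{1}{\log(1-\gamma_d)}$. *)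

theory Defs
  imports "HOL-Probability.Probability"
begin

text \<open>
  The dimension is \<open>CARD('d)\<close>, and the unit vectors \<open>e\<^sub>i\<close> are the vectors \<open>axis i 1\<close>.
  The two assumptions on single steps assign total mass 1, so they determine the common law;
  measurability of the steps is part of \<^const>\<open>prob_space.indep_vars\<close>.
  Steps are numbered from 1; \<open>X 0\<close> is irrelevant.
\<close>

locale simple_random_walk = prob_space M
  for M :: "'a measure" +
  fixes X :: "nat \<Rightarrow> 'a \<Rightarrow> int ^ 'd"
  assumes indep_steps: "indep_vars (\<lambda>_. count_space UNIV) X {1..}"
    and prob_step_pos:
      "k \<ge> 1 \<Longrightarrow> \<P>(\<omega> in M. X k \<omega> = axis i 1) = 1 / (2 * real CARD('d))"
    and prob_step_neg:
      "k \<ge> 1 \<Longrightarrow> \<P>(\<omega> in M. X k \<omega> = - axis i 1) = 1 / (2 * real CARD('d))"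

definition walk :: "(nat \<Rightarrow> 'a \<Rightarrow> int ^ 'd) \<Rightarrow> nat \<Rightarrow> 'a \<Rightarrow> int ^ 'd" where
  "walk X n \<omega> = (\<Sum>k=1..n. X k \<omega>)"

definition local_time :: "(nat \<Rightarrow> 'a \<Rightarrow> int ^ 'd) \<Rightarrow> int ^ 'd \<Rightarrow> nat \<Rightarrow> 'a \<Rightarrow> nat" where
  "local_time X x n \<omega> = card {k. 0 < k \<and> k \<le> n \<and> walk X k \<omega> = x}"

text \<open>
  Even for infinite \<open>A\<close> the maximum is over a finite set of values, since local times up to
  time \<open>n\<close> lie in \<open>{0..n}\<close>. For \<open>A = {}\<close> the value is unspecified.
\<close>

definition max_local_time ::
  "(nat \<Rightarrow> 'a \<Rightarrow> int ^ 'd) \<Rightarrow> (int ^ 'd) set \<Rightarrow> nat \<Rightarrow> 'a \<Rightarrow> nat" where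
  "max_local_time X A n \<omega> = (MAX x\<in>A. local_time X x n \<omega>)"

definition escape_prob :: "'a measure \<Rightarrow> (nat \<Rightarrow> 'a \<Rightarrow> int ^ 'd) \<Rightarrow> real" where
  "escape_prob M X = \<P>(\<omega> in M. \<forall>k\<ge>1. walk X k \<omega> \<noteq> 0)"

definition lambda_const :: "'a measure \<Rightarrow> (nat \<Rightarrow> 'a \<Rightarrow> int ^ 'd) \<Rightarrow> real" where
  "lambda_const M X = - 1 / ln (1 - escape_prob M X)"

definition int_hyperplane :: "int ^ 'd \<Rightarrow> (int ^ 'd) set" where
  "int_hyperplane a = {x. (\<Sum>i\<in>UNIV. a $ i * x $ i) = 0}"

end

theory Submission
  imports Defs
begin

text \<open>
  Write \<open>H\<close> for the hyperplane and \<open>q\<close> for the probability of ever returning to the start,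
  so \<open>\<lambda>\<^sub>d = - 1 / ln q\<close>. The integer walk \<open>a \<bullet> S\<^sub>n\<close> is symmetric with bounded steps, hence
  visits \<open>0\<close> about \<open>sqrt n\<close> times up to time \<open>n\<close>: that is how often the walk is in \<open>H\<close>. Each
  visit to \<open>H\<close> is a fresh chance for the current point to collect \<open>m\<close> further visits, and a
  chance succeeds with probability about \<open>q\<close> to the power \<open>m\<close>. With about \<open>sqrt n\<close> chances,
  the largest \<open>m\<close> that occurs solves \<open>sqrt n * q ^ m = 1\<close>, that is \<open>m = (\<lambda>\<^sub>d / 2) * ln n\<close>.

  The events to be estimated concern finitely many steps, so their probabilities are averages over
  the equally likely step lists of a given length; for these averages the Markov property is
  recursion on the first step.

  \<^item> Transience (\<open>0 < q < 1\<close>): \<open>(\<bar>x\<bar>\<^sup>2 + 1296) powr (- 1/4)\<close> is superharmonic on the lattice when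
    the dimension is at least three, with a strict maximum at the origin. It therefore bounds
    hitting probabilities of the origin away from 1 (\<open>return_prob_bounded_away_from_1\<close>).

  \<^item> Upper bound: a union bound over the first visit to a popular point of \<open>H\<close> gives at most
    \<open>q ^ m\<close> times the expected number of visits to \<open>H\<close> (\<open>popular_zero_point_prob_le\<close>). That
    expectation is \<open>O(sqrt n)\<close>, because \<open>\<bar>a \<bullet> S\<^sub>n\<bar>\<close> drifts upwards at each visit to \<open>0\<close>, while
    its mean is \<open>O(sqrt n)\<close> (\<open>green_upper_bound\<close>).

  \<^item> Lower bound: trials that start in \<open>H\<close> and are allowed \<open>L = O(ln n)\<close> steps each succeed
    independently (\<open>all_trials_fail_prob_le\<close>), and up to an event of small probability there
    are \<open>n powr (1/2 - \<epsilon>)\<close> of them (\<open>few_visits_prob_bound\<close>). The latter rests on the tail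
    \<open>O(1 / sqrt n)\<close> of the first return time of \<open>a \<bullet> S\<^sub>n\<close> to \<open>0\<close>, which follows from a
    last-exit decomposition and a lower bound of order \<open>sqrt n\<close> on the expected number of visits.

  Both error probabilities are summable along \<open>n = 2 ^ j\<close>, so Borel-Cantelli applies; since local
  times grow with \<open>n\<close> while \<open>ln n\<close> barely changes between consecutive powers of two, the
  limit along powers of two is the limit along all \<open>n\<close>.
\<close>

section \<open>Averages over uniformly random paths\<close>

locale uniform_steps =
  fixes S :: "'s set"
  assumes finite_S: "finite S" and S_nonempty: "S \<noteq> {}"
begin

definition paths :: "nat \<Rightarrow> 's list set" where
  "paths n = {l. set l \<subseteq> S \<and> length l = n}"

definition avg :: "('s \<Rightarrow> real) \<Rightarrow> real" where
  "avg F = (\<Sum>s\<in>S. F s) / real (card S)"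

definition E :: "nat \<Rightarrow> ('s list \<Rightarrow> real) \<Rightarrow> real" where
  "E n F = (\<Sum>l\<in>paths n. F l) / real (card S) ^ n"

definition Pr :: "nat \<Rightarrow> ('s list \<Rightarrow> bool) \<Rightarrow> real" where
  "Pr n Q = E n (\<lambda>l. of_bool (Q l))"

lemma card_S_pos: "0 < real (card S)"
  using finite_S S_nonempty by (simp add: card_gt_0_iff)

lemma finite_paths: "finite (paths n)"
  unfolding paths_def using finite_lists_length_eq[OF finite_S] .

lemma card_paths: "card (paths n) = card S ^ n"
  unfolding paths_def using card_lists_length_eq[OF finite_S] .

lemma avg_const: "avg (\<lambda>_. c) = c"
  using card_S_pos by (simp add: avg_def)

lemma avg_mono: "(\<And>s. s \<in> S \<Longrightarrow> F s \<le> G s) \<Longrightarrow> avg F \<le> avg G"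
  using card_S_pos by (simp add: avg_def divide_right_mono sum_mono)

lemma avg_cong: "(\<And>s. s \<in> S \<Longrightarrow> F s = G s) \<Longrightarrow> avg F = avg G"
  by (simp add: avg_def)

lemma avg_add: "avg (\<lambda>s. F s + G s) = avg F + avg G"
  by (simp add: avg_def sum.distrib add_divide_distrib)

lemma avg_diff: "avg (\<lambda>s. F s - G s) = avg F - avg G"
  by (simp add: avg_def sum_subtractf diff_divide_distrib)

lemma avg_cmult: "avg (\<lambda>s. c * F s) = c * avg F"
  by (simp add: avg_def sum_distrib_left)

lemma avg_cmult_right: "avg (\<lambda>s. F s * c) = avg F * c"
  by (simp add: avg_def sum_distrib_right)

lemma avg_sum: "avg (\<lambda>s. \<Sum>i\<in>I. F i s) = (\<Sum>i\<in>I. avg (F i))"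
  unfolding avg_def by (subst sum.swap) (simp add: sum_divide_distrib)

lemma E_0: "E 0 F = F []"
proof -
  have "paths 0 = {[]}" by (auto simp: paths_def)
  then show ?thesis by (simp add: E_def)
qed

lemma E_Suc: "E (Suc n) F = avg (\<lambda>s. E n (\<lambda>l. F (s # l)))"
proof -
  have "paths (Suc n) = (\<lambda>(s, l). s # l) ` (S \<times> paths n)"
    by (force simp: paths_def length_Suc_conv image_iff)
  moreover have "inj_on (\<lambda>(s, l). s # l) (S \<times> paths n)"
    by (auto simp: inj_on_def)
  ultimately have "(\<Sum>l\<in>paths (Suc n). F l) = (\<Sum>(s, l)\<in>S \<times> paths n. F (s # l))"
    by (simp add: sum.reindex case_prod_unfold)
  also have "\<dots> = (\<Sum>s\<in>S. \<Sum>l\<in>paths n. F (s # l))"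
    by (simp add: sum.cartesian_product)
  finally show ?thesis
    by (simp add: E_def avg_def sum_divide_distrib mult.commute)
qed

text \<open>
  The two halves of a random step list are independent; every use of the Markov property at a
  fixed time is an instance of this identity.
\<close>

lemma E_append: "E (m + n) F = E m (\<lambda>l. E n (\<lambda>l'. F (l @ l')))"
  by (induction m arbitrary: F) (simp_all add: E_0 E_Suc)

lemma E_mono: "(\<And>l. l \<in> paths n \<Longrightarrow> F l \<le> G l) \<Longrightarrow> E n F \<le> E n G"
  using card_S_pos by (simp add: E_def divide_right_mono sum_mono)

lemma E_cong: "(\<And>l. l \<in> paths n \<Longrightarrow> F l = G l) \<Longrightarrow> E n F = E n G"
  by (simp add: E_def)

lemma E_const: "E n (\<lambda>_. c) = c"
  using card_S_pos by (simp add: E_def card_paths)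

lemma E_add: "E n (\<lambda>l. F l + G l) = E n F + E n G"
  by (simp add: E_def sum.distrib add_divide_distrib)

lemma E_diff: "E n (\<lambda>l. F l - G l) = E n F - E n G"
  by (simp add: E_def sum_subtractf diff_divide_distrib)

lemma E_cmult: "E n (\<lambda>l. c * F l) = c * E n F"
  by (simp add: E_def sum_distrib_left)

lemma E_cmult_right: "E n (\<lambda>l. F l * c) = E n F * c"
  by (simp add: E_def sum_distrib_right)

lemma E_sum: "E n (\<lambda>l. \<Sum>i\<in>I. F i l) = (\<Sum>i\<in>I. E n (F i))"
  unfolding E_def by (subst sum.swap) (simp add: sum_divide_distrib)

lemma Pr_0: "Pr 0 Q = of_bool (Q [])"
  by (simp add: Pr_def E_0)

lemma Pr_Suc: "Pr (Suc n) Q = avg (\<lambda>s. Pr n (\<lambda>l. Q (s # l)))"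
  by (simp add: Pr_def E_Suc)

lemma Pr_mono: "(\<And>l. l \<in> paths n \<Longrightarrow> Q l \<Longrightarrow> R l) \<Longrightarrow> Pr n Q \<le> Pr n R"
  unfolding Pr_def by (rule E_mono) (auto simp: of_bool_def)

lemma Pr_cong: "(\<And>l. l \<in> paths n \<Longrightarrow> Q l \<longleftrightarrow> R l) \<Longrightarrow> Pr n Q = Pr n R"
  unfolding Pr_def by (rule E_cong) auto

lemma Pr_const: "Pr n (\<lambda>_. b) = of_bool b"
  by (simp add: Pr_def E_const)

lemma Pr_ge_0: "0 \<le> Pr n Q"
  using Pr_mono[of n "\<lambda>_. False" Q] by (simp add: Pr_const)

lemma Pr_le_1: "Pr n Q \<le> 1"
  using Pr_mono[of n Q "\<lambda>_. True"] by (simp add: Pr_const)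

lemma Pr_not: "Pr n (\<lambda>l. \<not> Q l) = 1 - Pr n Q"
proof -
  have "Pr n (\<lambda>l. \<not> Q l) = E n (\<lambda>l. 1 - of_bool (Q l))"
    unfolding Pr_def by (rule E_cong) auto
  then show ?thesis by (simp add: E_diff E_const Pr_def)
qed

lemma Pr_disj_le: "Pr n (\<lambda>l. Q l \<or> R l) \<le> Pr n Q + Pr n R"
  unfolding Pr_def E_add[symmetric] by (rule E_mono) auto

end

section \<open>Counting visits\<close>

text \<open>
  The walk starts at \<open>x\<close> and its steps are the images under \<open>c\<close> of the list entries. The
  target is always \<open>0\<close>, and a visit at time \<open>0\<close> does not count. With \<open>c\<close> the identity this
  counts visits of the lattice walk to a point; with \<open>c\<close> a linear form it counts, for the same
  step list, visits to the kernel of the form.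
\<close>

primrec visits :: "('s \<Rightarrow> 'g::ab_group_add) \<Rightarrow> 'g \<Rightarrow> 's list \<Rightarrow> nat" where
  "visits c x [] = 0"
| "visits c x (s # l) = of_bool (x + c s = 0) + visits c (x + c s) l"

lemma visits_append:
  "visits c x (l @ l') = visits c x l + visits c (x + sum_list (map c l)) l'"
  by (induction l arbitrary: x) (simp_all add: add.assoc)

lemma visits_le_length: "visits c x l \<le> length l"
proof (induction l arbitrary: x)
  case (Cons s l)
  show ?case using Cons[of "x + c s"] by (auto simp: of_bool_def)
qed simp

lemma visits_eq_card:
  "visits c x l = card {k. 0 < k \<and> k \<le> length l \<and> x + sum_list (map c (take k l)) = 0}"
proof (induction l rule: rev_induct)
  case Nil
  show ?case by (auto simp: card_eq_0_iff)
next
  case (snoc s l)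
  let ?K = "\<lambda>l. {k. 0 < k \<and> k \<le> length l \<and> x + sum_list (map c (take k l)) = 0}"
  let ?b = "x + sum_list (map c (l @ [s])) = 0"
  have "?K (l @ [s]) = ?K l \<union> (if ?b then {Suc (length l)} else {})"
    by (auto simp: le_Suc_eq)
  moreover have "finite (?K l)" and "Suc (length l) \<notin> ?K l" by auto
  ultimately have "card (?K (l @ [s])) = card (?K l) + of_bool ?b"
    by auto
  with snoc show ?case by (simp add: visits_append add.assoc)
qed

context uniform_steps
begin

definition visit_prob :: "('s \<Rightarrow> 'g::ab_group_add) \<Rightarrow> nat \<Rightarrow> 'g \<Rightarrow> nat \<Rightarrow> real" where
  "visit_prob c n x m = Pr n (\<lambda>l. m \<le> visits c x l)"

definition zero_prob :: "('s \<Rightarrow> 'g::ab_group_add) \<Rightarrow> nat \<Rightarrow> 'g \<Rightarrow> real" where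
  "zero_prob c k x = Pr k (\<lambda>l. x + sum_list (map c l) = 0)"

lemma visit_prob_zero: "visit_prob c n x 0 = 1"
  by (simp add: visit_prob_def Pr_const)

lemma visit_prob_time_0: "visit_prob c 0 x (Suc m) = 0"
  by (simp add: visit_prob_def Pr_0)

lemma visit_prob_Suc:
  "visit_prob c (Suc n) x (Suc m) =
    avg (\<lambda>s. if x + c s = 0 then visit_prob c n 0 m else visit_prob c n (x + c s) (Suc m))"
  unfolding visit_prob_def Pr_Suc by (rule avg_cong) (auto simp: of_bool_def)

lemma visit_prob_Suc_1:
  "visit_prob c (Suc n) x 1 = avg (\<lambda>s. if x + c s = 0 then 1 else visit_prob c n (x + c s) 1)"
  unfolding One_nat_def visit_prob_Suc visit_prob_zero ..

lemma visit_prob_time_0_1: "visit_prob c 0 x 1 = 0"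
  using visit_prob_time_0[of c x 0] by simp

lemma visit_prob_ge_0: "0 \<le> visit_prob c n x m"
  by (simp add: visit_prob_def Pr_ge_0)

lemma visit_prob_le_1: "visit_prob c n x m \<le> 1"
  by (simp add: visit_prob_def Pr_le_1)

lemma visit_prob_mono_time:
  assumes "n \<le> n'"
  shows "visit_prob c n x m \<le> visit_prob c n' x m"
proof -
  obtain j where j: "n' = n + j" using assms le_Suc_ex by blast
  have "Pr n (\<lambda>l. m \<le> visits c x l) = E n (\<lambda>l. E j (\<lambda>l'. of_bool (m \<le> visits c x l)))"
    by (simp add: Pr_def E_const)
  also have "\<dots> \<le> E n (\<lambda>l. E j (\<lambda>l'. of_bool (m \<le> visits c x (l @ l'))))"
    by (intro E_mono) (auto simp: visits_append)
  finally show ?thesis by (simp add: visit_prob_def Pr_def j E_append)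
qed

text \<open>
  To visit \<open>0\<close> for the \<open>Suc m\<close>-th time the walk must reach \<open>0\<close> at all, and then return \<open>m\<close> times
  in what is left of the \<open>n\<close> steps, hence in \<open>n\<close> steps.
\<close>

lemma visit_prob_submult:
  "visit_prob c n x (Suc m) \<le> visit_prob c n x 1 * visit_prob c n 0 m"
proof (induction n arbitrary: x)
  case (Suc n)
  have "visit_prob c (Suc n) x (Suc m) \<le>
      avg (\<lambda>s. (if x + c s = 0 then 1 else visit_prob c n (x + c s) 1)
        * visit_prob c n 0 m)"
    unfolding visit_prob_Suc using Suc by (intro avg_mono) auto
  also have "\<dots> = visit_prob c (Suc n) x 1 * visit_prob c n 0 m"
    by (simp only: avg_cmult_right visit_prob_Suc_1)
  also have "\<dots> \<le> visit_prob c (Suc n) x 1 * visit_prob c (Suc n) 0 m"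
    by (intro mult_left_mono visit_prob_mono_time visit_prob_ge_0) simp
  finally show ?case .
qed (simp add: visit_prob_time_0)

lemma visit_prob_le_power: "visit_prob c n 0 m \<le> visit_prob c n 0 1 ^ m"
proof (induction m)
  case (Suc m)
  have "visit_prob c n 0 (Suc m) \<le> visit_prob c n 0 1 * visit_prob c n 0 m"
    by (rule visit_prob_submult)
  also have "\<dots> \<le> visit_prob c n 0 1 * visit_prob c n 0 1 ^ m"
    by (intro mult_left_mono Suc visit_prob_ge_0)
  finally show ?case by simp
qed (simp add: visit_prob_zero)

text \<open>
  Conversely, if \<open>0\<close> is reached within \<open>n\<close> steps, at least \<open>n'\<close> of the \<open>n + n'\<close> steps remain for
  the \<open>m\<close> returns. Thus \<open>m\<close> returns need only a time linear in \<open>m\<close> to have probability close to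
  the \<open>m\<close>-th power of the return probability.
\<close>

lemma visit_prob_supermult:
  "visit_prob c n x 1 * visit_prob c n' 0 m \<le> visit_prob c (n + n') x (Suc m)"
proof (induction n arbitrary: x)
  case (Suc n)
  have "visit_prob c (Suc n) x 1 * visit_prob c n' 0 m =
      avg (\<lambda>s. (if x + c s = 0 then 1 else visit_prob c n (x + c s) 1)
        * visit_prob c n' 0 m)"
    by (simp only: avg_cmult_right visit_prob_Suc_1)
  also have "\<dots> \<le> visit_prob c (Suc n + n') x (Suc m)"
    unfolding visit_prob_Suc add_Suc using Suc
    by (intro avg_mono) (auto simp: visit_prob_mono_time)
  finally show ?case .
qed (simp add: visit_prob_time_0_1 visit_prob_ge_0 del: One_nat_def)

lemma power_le_visit_prob: "visit_prob c n 0 1 ^ m \<le> visit_prob c (n * m) 0 m"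
proof (induction m)
  case (Suc m)
  have "visit_prob c n 0 1 ^ Suc m \<le> visit_prob c n 0 1 * visit_prob c (n * m) 0 m"
    using Suc by (simp add: mult_left_mono visit_prob_ge_0)
  also have "\<dots> \<le> visit_prob c (n * Suc m) 0 (Suc m)"
    using visit_prob_supermult[of c n 0 "n * m" m] by simp
  finally show ?case .
qed (simp add: visit_prob_zero)

lemma zero_prob_0: "zero_prob c 0 x = of_bool (x = 0)"
  by (simp add: zero_prob_def Pr_0)

lemma zero_prob_Suc: "zero_prob c (Suc k) x = avg (\<lambda>s. zero_prob c k (x + c s))"
  by (simp add: zero_prob_def Pr_Suc add.assoc)

lemma zero_prob_ge_0: "0 \<le> zero_prob c k x"
  by (simp add: zero_prob_def Pr_ge_0)

text \<open>
  Split according to the last time \<open>k \<le> n\<close> spent at \<open>0\<close>, time \<open>0\<close> included. The extra term is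
  the event of not being at \<open>0\<close> at any time up to \<open>n\<close>.
\<close>

lemma last_exit_decomposition:
  "(\<Sum>k\<le>n. zero_prob c k x * (1 - visit_prob c (n - k) 0 1))
     + of_bool (x \<noteq> 0) * (1 - visit_prob c n x 1) = 1"
proof (induction n arbitrary: x)
  case 0
  show ?case by (simp add: zero_prob_0 visit_prob_time_0_1 del: One_nat_def)
next
  case (Suc n)
  have "(\<Sum>k\<le>Suc n. zero_prob c k x * (1 - visit_prob c (Suc n - k) 0 1)) =
      of_bool (x = 0) * (1 - visit_prob c (Suc n) 0 1)
      + (\<Sum>k\<le>n. avg (\<lambda>s. zero_prob c k (x + c s)) * (1 - visit_prob c (n - k) 0 1))"
    by (subst sum.atMost_Suc_shift) (simp add: zero_prob_0 zero_prob_Suc)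
  also have "(\<Sum>k\<le>n. avg (\<lambda>s. zero_prob c k (x + c s)) * (1 - visit_prob c (n - k) 0 1))
      = avg (\<lambda>s. \<Sum>k\<le>n. zero_prob c k (x + c s) * (1 - visit_prob c (n - k) 0 1))"
    by (simp only: avg_sum avg_cmult_right)
  also have "\<dots> = avg (\<lambda>s. 1 - of_bool (x + c s \<noteq> 0) * (1 - visit_prob c n (x + c s) 1))"
    using Suc by (intro avg_cong) (simp only: eq_diff_eq)
  also have "\<dots> = visit_prob c (Suc n) x 1"
    unfolding visit_prob_Suc_1 by (rule avg_cong) simp
  finally show ?case by auto
qed

text \<open>
  In the last-exit decomposition started at \<open>0\<close>, asking for no return during \<open>n\<close> instead of
  \<open>n - k\<close> steps only makes each term smaller.
\<close>

lemma no_return_le_inverse_green: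
  "(1 - visit_prob c n 0 1) * (\<Sum>k\<le>n. zero_prob c k 0) \<le> 1"
proof -
  have "(1 - visit_prob c n 0 1) * (\<Sum>k\<le>n. zero_prob c k 0) =
      (\<Sum>k\<le>n. zero_prob c k 0 * (1 - visit_prob c n 0 1))"
    by (simp add: sum_distrib_left mult.commute)
  also have "\<dots> \<le> (\<Sum>k\<le>n. zero_prob c k 0 * (1 - visit_prob c (n - k) 0 1))"
    by (intro sum_mono mult_left_mono zero_prob_ge_0 diff_left_mono visit_prob_mono_time) simp
  also have "\<dots> = 1"
    using last_exit_decomposition[of c 0 n] by simp
  finally show ?thesis .
qed

text \<open>
  The sum of \<open>1 - visit_prob c j x v\<close> over \<open>j < n\<close> is the mean of \<open>min \<tau> n\<close>, where \<open>\<tau>\<close> is the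
  time of the \<open>v\<close>-th visit to \<open>0\<close>, by summation of tails. Successive waiting times add up, and
  \<open>min (s + t) n \<le> min s n + min t n\<close>. Truncation is needed because for an integer walk the
  waiting times have infinite mean.
\<close>

lemma truncated_time_subadditive:
  "(\<Sum>j<n. 1 - visit_prob c j x (Suc v)) \<le>
    (\<Sum>j<n. 1 - visit_prob c j x 1) + (\<Sum>j<n. 1 - visit_prob c j 0 v)"
proof (induction n arbitrary: x)
  case (Suc n)
  define R where "R n x v = (\<Sum>j<n. 1 - visit_prob c j x v)" for n x v
  have R_Suc: "R (Suc n) x (Suc v) =
      1 + avg (\<lambda>s. if x + c s = 0 then R n 0 v else R n (x + c s) (Suc v))" for x v
  proof -
    have "R (Suc n) x (Suc v) = 1 + (\<Sum>j<n. 1 - visit_prob c (Suc j) x (Suc v))"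
      unfolding R_def by (subst sum.lessThan_Suc_shift) (simp add: visit_prob_time_0)
    also have "(\<Sum>j<n. 1 - visit_prob c (Suc j) x (Suc v)) = (\<Sum>j<n. avg (\<lambda>s. 1 -
        (if x + c s = 0 then visit_prob c j 0 v else visit_prob c j (x + c s) (Suc v))))"
      by (simp only: visit_prob_Suc avg_diff avg_const)
    also have "\<dots> = avg (\<lambda>s. if x + c s = 0 then R n 0 v else R n (x + c s) (Suc v))"
      unfolding avg_sum[symmetric] by (rule avg_cong) (auto simp: R_def)
    finally show ?thesis .
  qed
  have R_0: "R n 0 0 = 0" by (simp add: R_def visit_prob_zero)
  have "R (Suc n) x (Suc v) \<le>
      1 + avg (\<lambda>s. (if x + c s = 0 then R n 0 0 else R n (x + c s) (Suc 0)) + R n 0 v)"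
    unfolding R_Suc using Suc by (intro add_left_mono avg_mono) (auto simp: R_0 simp flip: R_def)
  also have "\<dots> = R (Suc n) x (Suc 0) + R n 0 v"
    by (simp add: avg_add avg_const R_Suc)
  also have "\<dots> \<le> R (Suc n) x 1 + R (Suc n) 0 v"
    by (simp add: R_def visit_prob_le_1)
  finally show ?case by (simp add: R_def)
qed simp

text \<open>
  Markov's inequality for the truncated time of the \<open>v\<close>-th visit, whose mean is at most \<open>v\<close>
  times that of the truncated first return time.
\<close>

lemma few_visits_prob_le:
  "real n * (1 - visit_prob c n 0 v) \<le> real v * (\<Sum>j<n. 1 - visit_prob c j 0 1)"
proof -
  have "real n * (1 - visit_prob c n 0 v) = (\<Sum>j<n. 1 - visit_prob c n 0 v)"
    by simp
  also have "\<dots> \<le> (\<Sum>j<n. 1 - visit_prob c j 0 v)"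
    by (intro sum_mono diff_left_mono visit_prob_mono_time) simp
  also have "\<dots> \<le> real v * (\<Sum>j<n. 1 - visit_prob c j 0 1)"
  proof (induction v)
    case (Suc v)
    show ?case using truncated_time_subadditive[of c 0 v n] Suc by (simp add: algebra_simps)
  qed (simp add: visit_prob_zero)
  finally show ?thesis .
qed

end

section \<open>Visits to zero of a symmetric integer walk\<close>

lemma sum_inverse_sqrt_le: "(\<Sum>j<n. 1 / sqrt (real (Suc j))) \<le> 2 * sqrt (real n)"
proof (induction n)
  case (Suc n)
  have "1 / sqrt (real (Suc n)) \<le> 2 * (sqrt (real (Suc n)) - sqrt (real n))"
  proof -
    let ?a = "sqrt (real (Suc n))" and ?b = "sqrt (real n)"
    have "?a > 0" and ab: "?a * ?a = ?b * ?b + 1" by auto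
    have "0 \<le> (?a - ?b) * (?a - ?b)" by simp
    then have "1 \<le> 2 * (?a - ?b) * ?a" using ab by (simp add: algebra_simps)
    then show ?thesis using \<open>?a > 0\<close> by (simp add: field_simps)
  qed
  with Suc show ?case by simp
qed simp

locale symmetric_steps = uniform_steps S
  for S :: "'s::ab_group_add set" +
  fixes \<phi> :: "'s \<Rightarrow> int"
  assumes uminus_S: "s \<in> S \<Longrightarrow> - s \<in> S"
    and \<phi>_minus: "\<phi> (- s) = - \<phi> s"
    and \<phi>_nonzero: "\<exists>s\<in>S. \<phi> s \<noteq> 0"
begin

definition endpoint :: "'s list \<Rightarrow> int" where
  "endpoint l = sum_list (map \<phi> l)"

definition step_variance :: real where "step_variance = avg (\<lambda>s. (real_of_int (\<phi> s))\<^sup>2)"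

definition mean_abs_step :: real where "mean_abs_step = avg (\<lambda>s. \<bar>real_of_int (\<phi> s)\<bar>)"

lemma endpoint_simps: "endpoint [] = 0" "endpoint (s # l) = \<phi> s + endpoint l" "endpoint (l @ l') = endpoint l + endpoint l'"
  by (simp_all add: endpoint_def)

lemma avg_uminus: "avg (\<lambda>s. F (- s)) = avg F"
proof -
  have "bij_betw uminus S S"
    by (rule bij_betw_byWitness[where f' = uminus]) (auto simp: uminus_S)
  then show ?thesis
    unfolding avg_def by (simp add: sum.reindex_bij_betw)
qed

lemma avg_\<phi>: "avg (\<lambda>s. real_of_int (\<phi> s)) = 0"
  using avg_uminus[of "\<lambda>s. real_of_int (\<phi> s)"] avg_cmult[of "-1" "\<lambda>s. real_of_int (\<phi> s)"]
  by (simp add: \<phi>_minus)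

lemma mean_abs_step_pos: "0 < mean_abs_step"
proof -
  obtain s where "s \<in> S" "\<phi> s \<noteq> 0" using \<phi>_nonzero by blast
  then have "0 < (\<Sum>s\<in>S. \<bar>real_of_int (\<phi> s)\<bar>)"
    by (intro sum_pos2[of _ s]) (auto simp: finite_S)
  then show ?thesis using card_S_pos by (simp add: mean_abs_step_def avg_def)
qed

lemma step_variance_ge_0: "0 \<le> step_variance"
  by (simp add: step_variance_def avg_def sum_nonneg)

lemma zero_prob_sym: "zero_prob \<phi> k (- x) = zero_prob \<phi> k x"
proof (induction k arbitrary: x)
  case (Suc k)
  have "zero_prob \<phi> (Suc k) (- x) = avg (\<lambda>s. zero_prob \<phi> k (- (x + \<phi> (- s))))"
    by (simp add: zero_prob_Suc \<phi>_minus)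
  also have "\<dots> = avg (\<lambda>s. zero_prob \<phi> k (x + \<phi> (- s)))"
    by (simp only: Suc)
  also have "\<dots> = avg (\<lambda>s. zero_prob \<phi> k (x + \<phi> s))"
    using avg_uminus[of "\<lambda>s. zero_prob \<phi> k (x + \<phi> s)"] by simp
  finally show ?case by (simp add: zero_prob_Suc)
qed (simp add: zero_prob_0)

lemma second_moment: "E n (\<lambda>l. (real_of_int (x + endpoint l))\<^sup>2) = (real_of_int x)\<^sup>2 + real n * step_variance"
proof (induction n arbitrary: x)
  case (Suc n)
  have "E (Suc n) (\<lambda>l. (real_of_int (x + endpoint l))\<^sup>2) =
      avg (\<lambda>s. E n (\<lambda>l. (real_of_int ((x + \<phi> s) + endpoint l))\<^sup>2))"
    by (simp only: E_Suc endpoint_simps add.assoc)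
  also have "\<dots> = avg (\<lambda>s. (real_of_int (x + \<phi> s))\<^sup>2 + real n * step_variance)"
    by (simp only: Suc)
  also have "\<dots> = avg (\<lambda>s. ((real_of_int x)\<^sup>2 + real n * step_variance) + 2 * real_of_int x * real_of_int (\<phi> s)
      + (real_of_int (\<phi> s))\<^sup>2)"
    by (rule avg_cong) (simp add: power2_eq_square algebra_simps)
  also have "\<dots> = (real_of_int x)\<^sup>2 + real (Suc n) * step_variance"
    by (simp only: avg_add avg_const avg_cmult avg_\<phi> flip: step_variance_def) (simp add: algebra_simps)
  finally show ?case .
qed (simp add: E_0 endpoint_simps)

text \<open>
  The absolute value of the walk never drifts downwards, and at each visit to \<open>0\<close> it gains
  \<open>mean_abs_step\<close> on average. So its mean dominates the expected number of visits.
\<close>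

lemma abs_moment_ge:
  "\<bar>real_of_int x\<bar> + mean_abs_step * (\<Sum>k<n. zero_prob \<phi> k x) \<le> E n (\<lambda>l. \<bar>real_of_int (x + endpoint l)\<bar>)"
proof (induction n arbitrary: x)
  case (Suc n)
  have drift: "\<bar>real_of_int x\<bar> + mean_abs_step * of_bool (x = 0) \<le> avg (\<lambda>s. \<bar>real_of_int (x + \<phi> s)\<bar>)"
  proof (cases "x = 0")
    case False
    have "avg (\<lambda>s. real_of_int (x + \<phi> s)) = real_of_int x"
      by (simp add: avg_add avg_const avg_\<phi>)
    moreover have "avg (\<lambda>s. - real_of_int (x + \<phi> s)) = - real_of_int x"
      using avg_cmult[of "-1" "\<lambda>s. real_of_int (x + \<phi> s)"] calculation by simp
    moreover have "avg (\<lambda>s. real_of_int (x + \<phi> s)) \<le> avg (\<lambda>s. \<bar>real_of_int (x + \<phi> s)\<bar>)"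
      and "avg (\<lambda>s. - real_of_int (x + \<phi> s)) \<le> avg (\<lambda>s. \<bar>real_of_int (x + \<phi> s)\<bar>)"
      by (intro avg_mono; simp)+
    ultimately show ?thesis using False by simp
  qed (simp add: mean_abs_step_def)
  have "(\<Sum>k<Suc n. zero_prob \<phi> k x) =
      of_bool (x = 0) + avg (\<lambda>s. \<Sum>k<n. zero_prob \<phi> k (x + \<phi> s))"
    by (subst sum.lessThan_Suc_shift) (simp add: zero_prob_0 zero_prob_Suc avg_sum)
  then have "\<bar>real_of_int x\<bar> + mean_abs_step * (\<Sum>k<Suc n. zero_prob \<phi> k x) \<le>
      avg (\<lambda>s. \<bar>real_of_int (x + \<phi> s)\<bar>) + avg (\<lambda>s. mean_abs_step * (\<Sum>k<n. zero_prob \<phi> k (x + \<phi> s)))"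
    using drift by (simp add: avg_cmult algebra_simps)
  also have "\<dots> \<le> avg (\<lambda>s. E n (\<lambda>l. \<bar>real_of_int ((x + \<phi> s) + endpoint l)\<bar>))"
    unfolding avg_add[symmetric] by (rule avg_mono) (rule Suc)
  also have "\<dots> = E (Suc n) (\<lambda>l. \<bar>real_of_int (x + endpoint l)\<bar>)"
    by (simp only: E_Suc endpoint_simps add.assoc)
  finally show ?case .
qed (simp add: E_0 endpoint_simps)

lemma green_upper_bound:
  "\<exists>C>0. \<forall>n. (\<Sum>k<n. zero_prob \<phi> k 0) \<le> C * sqrt (real n)"
proof (intro exI conjI allI)
  show "0 < (step_variance + 1) / (2 * mean_abs_step)" using step_variance_ge_0 mean_abs_step_pos by simp
  fix n :: nat
  show "(\<Sum>k<n. zero_prob \<phi> k 0) \<le> (step_variance + 1) / (2 * mean_abs_step) * sqrt (real n)"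
  proof (cases "n = 0")
    case False
    let ?t = "sqrt (real n)"
    have t: "?t > 0" "?t * ?t = real n" using False by auto
    have "mean_abs_step * (\<Sum>k<n. zero_prob \<phi> k 0) \<le> E n (\<lambda>l. \<bar>real_of_int (endpoint l)\<bar>)"
      using abs_moment_ge[of 0 n] by simp
    also have "\<dots> \<le> E n (\<lambda>l. 1 / (2 * ?t) * (real_of_int (endpoint l))\<^sup>2 + ?t / 2)"
    proof (rule E_mono)
      fix l
      \<comment> \<open>The mean absolute value is controlled by the second moment; weighting by the
        standard deviation scale \<open>sqrt n\<close> makes both terms of the same order.\<close>
      have "0 \<le> (\<bar>real_of_int (endpoint l)\<bar> - ?t)\<^sup>2" by simp
      then show "\<bar>real_of_int (endpoint l)\<bar> \<le> 1 / (2 * ?t) * (real_of_int (endpoint l))\<^sup>2 + ?t / 2"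
        using t by (simp add: field_simps power2_eq_square)
    qed
    also have "\<dots> = 1 / (2 * ?t) * (real n * step_variance) + ?t / 2"
      using second_moment[of n 0] by (simp only: E_add E_cmult E_const) simp
    also have "\<dots> = 1 / (2 * ?t) * ((?t * ?t) * step_variance) + ?t / 2"
      by (simp only: t(2))
    also have "\<dots> = ?t * (step_variance + 1) / 2"
      using t(1) by (simp add: field_simps del: real_sqrt_mult_self)
    finally show ?thesis using mean_abs_step_pos by (simp add: field_simps)
  qed simp
qed

lemma zero_prob_eq: "Pr k (\<lambda>l. endpoint l = y) = zero_prob \<phi> k y"
proof -
  have "Pr k (\<lambda>l. endpoint l = y) = zero_prob \<phi> k (- y)"
    unfolding zero_prob_def by (rule Pr_cong) (auto simp: endpoint_def)
  then show ?thesis by (simp add: zero_prob_sym)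
qed

text \<open>
  By symmetry, being at \<open>0\<close> at time \<open>2 k\<close> means that two independent walks of length \<open>k\<close> end
  at the same point. The collision probability is at least the sum of the squared point
  probabilities over a window, and Cauchy-Schwarz compares this with the mass of the window.
\<close>

lemma zero_prob_even_ge:
  "(\<Sum>y\<in>{- int R..int R}. zero_prob \<phi> k y)\<^sup>2 \<le> real (2 * R + 1) * zero_prob \<phi> (k + k) 0"
proof -
  let ?A = "{- int R..int R}"
  have "(\<Sum>y\<in>?A. (zero_prob \<phi> k y)\<^sup>2) = E k (\<lambda>l. \<Sum>y\<in>?A. of_bool (endpoint l = y) * zero_prob \<phi> k y)"
    by (simp only: E_sum E_cmult_right power2_eq_square) (simp add: Pr_def flip: zero_prob_eq)
  also have "\<dots> \<le> E k (\<lambda>l. zero_prob \<phi> k (endpoint l))"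
    by (rule E_mono) (simp add: of_bool_def if_distrib sum.delta zero_prob_ge_0
        if_distribR cong: if_cong)
  also have "\<dots> = zero_prob \<phi> (k + k) 0"
    by (simp add: zero_prob_def Pr_def E_append endpoint_def)
  finally have "(\<Sum>y\<in>?A. (zero_prob \<phi> k y)\<^sup>2) \<le> zero_prob \<phi> (k + k) 0" .
  moreover have "(\<Sum>y\<in>?A. zero_prob \<phi> k y)\<^sup>2 \<le> (\<Sum>y\<in>?A. (zero_prob \<phi> k y)\<^sup>2) * real (card ?A)"
    by (rule sum_squared_le_sum_of_squares)
  moreover have "real (card ?A) = real (2 * R + 1)" by simp
  ultimately show ?thesis
    by (smt (verit, best) mult.commute mult_right_mono of_nat_0_le_iff)
qed

lemma chebyshev_endpoint:
  assumes "0 < R"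
  shows "1 - real n * step_variance / (real R)\<^sup>2 \<le> (\<Sum>y\<in>{- int R..int R}. zero_prob \<phi> n y)"
proof -
  let ?A = "{- int R..int R}"
  have "1 - real n * step_variance / (real R)\<^sup>2 = E n (\<lambda>l. 1 - 1 / (real R)\<^sup>2 * (real_of_int (endpoint l))\<^sup>2)"
    using second_moment[of n 0] by (simp only: E_diff E_const E_cmult) simp
  also have "\<dots> \<le> E n (\<lambda>l. \<Sum>y\<in>?A. of_bool (endpoint l = y))"
  proof (rule E_mono)
    fix l
    show "1 - 1 / (real R)\<^sup>2 * (real_of_int (endpoint l))\<^sup>2 \<le> (\<Sum>y\<in>?A. of_bool (endpoint l = y))"
    proof (cases "endpoint l \<in> ?A")
      case False
      then have "int R \<le> \<bar>endpoint l\<bar>" by auto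
      then have "real R \<le> \<bar>real_of_int (endpoint l)\<bar>" by linarith
      then have "(real R)\<^sup>2 \<le> (real_of_int (endpoint l))\<^sup>2"
        by (metis abs_le_square_iff abs_of_nat)
      moreover have "(\<Sum>y\<in>?A. of_bool (endpoint l = y)) = (0::real)"
        using False by (intro sum.neutral) auto
      ultimately show ?thesis using assms by simp
    next
      case True
      then have "(\<Sum>y\<in>?A. of_bool (endpoint l = y)) = (1::real)"
        by (simp add: of_bool_def sum.delta)
      then show ?thesis by simp
    qed
  qed
  also have "\<dots> = (\<Sum>y\<in>?A. zero_prob \<phi> n y)"
    by (simp only: E_sum) (simp add: Pr_def flip: zero_prob_eq)
  finally show ?thesis .
qed

text \<open>
  By Chebyshev a window of width of order \<open>sqrt k\<close> carries half of the mass at time \<open>k\<close>, so the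
  return probability at time \<open>2 k\<close> is at least of order \<open>1 / sqrt k\<close>.
\<close>

lemma green_lower_bound:
  "\<exists>c>0. \<forall>n. c * sqrt (real (Suc n)) \<le> (\<Sum>k\<le>n. zero_prob \<phi> k 0)"
proof -
  \<comment> \<open>The window radius is \<open>b * sqrt (k + 1)\<close>; any \<open>b\<close> with \<open>2 * step_variance \<le> b\<^sup>2\<close> keeps half
    of the mass inside, and \<open>b \<ge> 1\<close> absorbs the rounding.\<close>
  define b where "b = 2 * step_variance + 1"
  have b: "b \<ge> 1" using step_variance_ge_0 by (simp add: b_def)
  define c where "c = 1 / (4 * (2 * b + 3))"
  have c: "c > 0" using b by (simp add: c_def)
  have even: "c / sqrt (real (Suc k)) \<le> zero_prob \<phi> (k + k) 0" for k
  proof -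
    let ?t = "sqrt (real (Suc k))"
    have t: "1 \<le> ?t" "?t * ?t = real (Suc k)" by auto
    define R where "R = nat \<lceil>b * ?t\<rceil>"
    have R: "b * ?t \<le> real R" "real R \<le> b * ?t + 1"
      using b t(1) by (simp_all add: R_def)
    have bt: "1 \<le> b * ?t" using mult_mono[OF b t(1)] b by simp
    have "2 * (real k * step_variance) \<le> real (Suc k) * b"
      using step_variance_ge_0 b by (simp add: b_def algebra_simps)
    also have "\<dots> \<le> real (Suc k) * b * b" using b by simp
    also have "\<dots> = (b * ?t)\<^sup>2"
      by (simp add: power_mult_distrib power2_eq_square)
    also have "\<dots> \<le> (real R)\<^sup>2" using R(1) bt by (intro power_mono) auto
    finally have "real k * step_variance / (real R)\<^sup>2 \<le> 1 / 2" using R bt by (simp add: field_simps)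
    moreover have "0 < R" using R bt by linarith
    ultimately have "1 / 2 \<le> (\<Sum>y\<in>{- int R..int R}. zero_prob \<phi> k y)"
      using chebyshev_endpoint[of R k] by linarith
    then have "(1 / 2)\<^sup>2 \<le> (\<Sum>y\<in>{- int R..int R}. zero_prob \<phi> k y)\<^sup>2"
      by (rule power_mono) simp
    also have "\<dots> \<le> real (2 * R + 1) * zero_prob \<phi> (k + k) 0"
      by (rule zero_prob_even_ge)
    also have "\<dots> \<le> ((2 * b + 3) * ?t) * zero_prob \<phi> (k + k) 0"
    proof (intro mult_right_mono zero_prob_ge_0)
      have "(2 * b + 3) * ?t = 2 * (b * ?t) + 3 * ?t" by (simp only: algebra_simps)
      then show "real (2 * R + 1) \<le> (2 * b + 3) * ?t" using R(2) t(1) by linarith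
    qed
    finally have "1 / 4 \<le> (2 * b + 3) * (?t * zero_prob \<phi> (k + k) 0)"
      by (simp add: power2_eq_square mult.assoc)
    then have "c \<le> ?t * zero_prob \<phi> (k + k) 0"
      using b by (simp add: c_def field_simps)
    then show ?thesis using t by (simp add: field_simps)
  qed
  have "c / 2 * sqrt (real (Suc n)) \<le> (\<Sum>k\<le>n. zero_prob \<phi> k 0)" for n
  proof -
    let ?t = "sqrt (real (Suc n))"
    have t: "0 < ?t" "?t * ?t = real (Suc n)" by auto
    have "c / 2 * ?t = (?t * ?t / 2) * (c / ?t)"
      using t(1) by (simp add: field_simps del: real_sqrt_mult_self)
    also have "\<dots> = (real (Suc n) / 2) * (c / ?t)"
      by (simp only: t(2))
    also have "\<dots> \<le> real (Suc (n div 2)) * (c / ?t)"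
      using c by (intro mult_right_mono) auto
    also have "\<dots> = (\<Sum>k\<le>n div 2. c / ?t)" by simp
    also have "\<dots> \<le> (\<Sum>k\<le>n div 2. zero_prob \<phi> (k + k) 0)"
    proof (rule sum_mono)
      fix k assume "k \<in> {..n div 2}"
      then have "c / ?t \<le> c / sqrt (real (Suc k))"
        using c by (intro divide_left_mono) auto
      then show "c / ?t \<le> zero_prob \<phi> (k + k) 0" using even[of k] by linarith
    qed
    also have "\<dots> = (\<Sum>k\<in>(\<lambda>k. k + k) ` {..n div 2}. zero_prob \<phi> k 0)"
      by (subst sum.reindex) (auto simp: inj_on_def)
    also have "\<dots> \<le> (\<Sum>k\<le>n. zero_prob \<phi> k 0)"
      by (rule sum_mono2) (auto simp: zero_prob_ge_0)
    finally show ?thesis .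
  qed
  then show ?thesis using c by (intro exI[of _ "c / 2"]) auto
qed

text \<open>
  Return times with tail \<open>O(1 / sqrt j)\<close> have truncated mean \<open>O(sqrt n)\<close>. Markov's inequality then
  shows that \<open>v\<close> visits fail to happen within \<open>n\<close> steps only with probability \<open>O(v / sqrt n)\<close>,
  which is small for every \<open>v\<close> below the typical order \<open>sqrt n\<close>.
\<close>

lemma few_visits_prob_bound:
  "\<exists>C>0. \<forall>n>0. \<forall>v. 1 - visit_prob \<phi> n 0 v \<le> C * real v / sqrt (real n)"
proof -
  obtain c where c: "c > 0" "\<And>n. c * sqrt (real (Suc n)) \<le> (\<Sum>k\<le>n. zero_prob \<phi> k 0)"
    using green_lower_bound by blast
  have tail: "1 - visit_prob \<phi> j 0 1 \<le> 1 / c * (1 / sqrt (real (Suc j)))" for j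
  proof -
    have "(1 - visit_prob \<phi> j 0 1) * (c * sqrt (real (Suc j))) \<le> 1"
      using mult_left_mono[OF c(2)[of j], of "1 - visit_prob \<phi> j 0 1"]
        no_return_le_inverse_green[of \<phi> j] visit_prob_le_1[of \<phi> j 0 1] by linarith
    then show ?thesis using c(1) by (simp add: field_simps del: of_nat_Suc)
  qed
  have "1 - visit_prob \<phi> n 0 v \<le> (2 / c) * real v / sqrt (real n)" if "n > 0" for n v
  proof -
    let ?t = "sqrt (real n)"
    have t: "0 < ?t" "?t * ?t = real n" using that by auto
    have "(\<Sum>j<n. 1 - visit_prob \<phi> j 0 1) \<le> (\<Sum>j<n. 1 / c * (1 / sqrt (real (Suc j))))"
      by (intro sum_mono tail)
    also have "\<dots> \<le> 1 / c * (2 * ?t)"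
      unfolding sum_distrib_left[symmetric] using c(1)
      by (intro mult_left_mono sum_inverse_sqrt_le) auto
    finally have "real v * (\<Sum>j<n. 1 - visit_prob \<phi> j 0 1) \<le> real v * (1 / c * (2 * ?t))"
      by (rule mult_left_mono) simp
    then have "(?t * ?t) * (1 - visit_prob \<phi> n 0 v) \<le> real v * (1 / c * (2 * ?t))"
      unfolding t(2) by (rule order_trans[OF few_visits_prob_le])
    then have "?t * (1 - visit_prob \<phi> n 0 v) \<le> real v * (1 / c * 2)"
    proof -
      assume "(?t * ?t) * (1 - visit_prob \<phi> n 0 v) \<le> real v * (1 / c * (2 * ?t))"
      moreover have "real v * (1 / c * (2 * ?t)) = ?t * (real v * (1 / c * 2))" by simp
      ultimately have "?t * (?t * (1 - visit_prob \<phi> n 0 v)) \<le> ?t * (real v * (1 / c * 2))"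
        by (simp only: mult.assoc)
      then show ?thesis using t(1) by (simp only: mult_le_cancel_left_pos)
    qed
    moreover have "2 / c * real v = real v * (1 / c * 2)" by simp
    ultimately show ?thesis
      by (simp only: pos_le_divide_eq[OF t(1)] mult.commute[of "1 - visit_prob \<phi> n 0 v"])
  qed
  then show ?thesis using c(1) by (intro exI[of _ "2 / c"]) auto
qed

end

section \<open>Points with many visits\<close>

context symmetric_steps
begin

text \<open>
  Here \<open>y\<close> is the value of the form at the current position, and a point is named by its
  displacement \<open>x\<close> from there. Look at the first visit to a point of the kernel that is visited
  more than \<open>m\<close> times: the walk is in the kernel at that time \<open>k\<close>, and then returns \<open>m\<close> times to
  where it is. Summing over \<open>k\<close> gives the bound, so each visit to the kernel contributes
  one term \<open>q\<close>, no matter how many points the kernel has.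
\<close>

lemma popular_zero_point_prob_le:
  assumes add: "\<And>s t. \<phi> (s + t) = \<phi> s + \<phi> t"
    and q: "\<And>n. visit_prob (\<lambda>s. s) n 0 m \<le> q"
  shows "Pr n (\<lambda>l. \<exists>x. y + \<phi> x = 0 \<and> Suc m \<le> visits (\<lambda>s. s) (- x) l)
    \<le> q * (\<Sum>k=1..n. zero_prob \<phi> k y)"
proof (induction n arbitrary: y)
  case 0
  show ?case by (simp add: Pr_0)
next
  case (Suc n)
  let ?A = "\<lambda>y l. \<exists>x. y + \<phi> x = 0 \<and> Suc m \<le> visits (\<lambda>s. s) (- x) l"
  have sub: "\<phi> (x - s) = \<phi> x - \<phi> s" for x s
    using add[of x "- s"] \<phi>_minus[of s] by simp
  have "Pr (Suc n) (?A y) \<le>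
      avg (\<lambda>s. q * of_bool (y + \<phi> s = 0) + q * (\<Sum>k=1..n. zero_prob \<phi> k (y + \<phi> s)))"
    unfolding Pr_Suc
  proof (rule avg_mono)
    fix s assume "s \<in> S"
    \<comment> \<open>Either the first step leads to the popular point itself, so that \<open>m\<close> returns must
      follow, or the point is still unvisited and the same event occurs for the remaining walk.\<close>
    have "?A (y + \<phi> s) l \<or> (y + \<phi> s = 0 \<and> m \<le> visits (\<lambda>s. s) 0 l)" if "?A y (s # l)" for l
    proof -
      from that obtain x where x: "y + \<phi> x = 0" "Suc m \<le> visits (\<lambda>s. s) (- x) (s # l)"
        by blast
      show ?thesis
      proof (cases "s = x")
        case True
        then show ?thesis using x by simp
      next
        case False
        then have "- x + s \<noteq> 0" by (metis add.commute right_minus_eq uminus_add_conv_diff)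
        then have "Suc m \<le> visits (\<lambda>s. s) (- (x - s)) l" using x(2) by simp
        moreover have "(y + \<phi> s) + \<phi> (x - s) = 0" using x(1) by (simp add: sub)
        ultimately show ?thesis by blast
      qed
    qed
    then have "Pr n (\<lambda>l. ?A y (s # l)) \<le>
        Pr n (\<lambda>l. ?A (y + \<phi> s) l \<or> (y + \<phi> s = 0 \<and> m \<le> visits (\<lambda>s. s) 0 l))"
      by (rule Pr_mono)
    also have "\<dots> \<le> Pr n (?A (y + \<phi> s)) + Pr n (\<lambda>l. y + \<phi> s = 0 \<and> m \<le> visits (\<lambda>s. s) 0 l)"
      by (rule Pr_disj_le)
    also have "Pr n (\<lambda>l. y + \<phi> s = 0 \<and> m \<le> visits (\<lambda>s. s) 0 l) \<le> q * of_bool (y + \<phi> s = 0)"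
      using q[of n] by (cases "y + \<phi> s = 0") (simp_all add: Pr_const visit_prob_def)
    finally show "Pr n (\<lambda>l. ?A y (s # l)) \<le>
        q * of_bool (y + \<phi> s = 0) + q * (\<Sum>k=1..n. zero_prob \<phi> k (y + \<phi> s))"
      using Suc[of "y + \<phi> s"] by linarith
  qed
  also have "\<dots> = q * avg (\<lambda>s. \<Sum>k=0..n. zero_prob \<phi> k (y + \<phi> s))"
    by (simp add: sum.atLeast_Suc_atMost[of 0 n] zero_prob_0 flip: avg_cmult distrib_left)
  also have "avg (\<lambda>s. \<Sum>k=0..n. zero_prob \<phi> k (y + \<phi> s)) = (\<Sum>k=0..n. zero_prob \<phi> (Suc k) y)"
    by (simp only: avg_sum zero_prob_Suc)
  also have "\<dots> = (\<Sum>k=1..Suc n. zero_prob \<phi> k y)"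
    by (subst sum.shift_bounds_cl_Suc_ivl[symmetric]) simp
  finally show ?case .
qed

text \<open>
  A trial starts whenever the walk is in the kernel of the form, so trials overlap; the estimate
  of the failure probability uses a disjoint family of them. Limiting a trial to \<open>L\<close> steps is
  what makes disjoint trials independent.
\<close>

definition trial_success :: "nat \<Rightarrow> nat \<Rightarrow> int \<Rightarrow> 's list \<Rightarrow> bool" where
  "trial_success L m y l \<longleftrightarrow>
    (\<exists>k. k + L \<le> length l \<and> y + endpoint (take k l) = 0 \<and> m \<le> visits (\<lambda>s. s) 0 (take L (drop k l)))"

lemma trial_success_Cons:
  assumes "trial_success L m (y + \<phi> s) l"
  shows "trial_success L m y (s # l)"
proof -
  obtain k where "k + L \<le> length l" "y + \<phi> s + endpoint (take k l) = 0"
    "m \<le> visits (\<lambda>s. s) 0 (take L (drop k l))"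
    using assms unfolding trial_success_def by blast
  then show ?thesis unfolding trial_success_def
    by (intro exI[of _ "Suc k"]) (simp add: endpoint_simps add.assoc)
qed

lemma trial_success_append:
  assumes "trial_success L m (y + endpoint l) l'"
  shows "trial_success L m y (l @ l')"
  using assms
proof (induction l arbitrary: y)
  case (Cons s l)
  then have "trial_success L m (y + \<phi> s) (l @ l')" by (simp add: endpoint_simps add.assoc)
  then show ?case by (simp add: trial_success_Cons)
qed (simp add: endpoint_simps)

text \<open>
  A trial uses up at most \<open>L\<close> visits to the kernel and each waiting period for the next trial ends
  with one more, so \<open>N * Suc L\<close> visits leave room for \<open>N\<close> trials over disjoint stretches of time.
  These are independent. If the walk already starts in the kernel, the first waiting period is
  missing, and one visit fewer is enough; without this case the induction would lose a visit each
  time the walk enters the kernel.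
\<close>

lemma all_trials_fail_prob_le:
  assumes "0 < L"
    and "N * Suc L \<le> v \<or> y = 0 \<and> N * Suc L \<le> Suc v"
  shows "Pr n (\<lambda>l. v \<le> visits \<phi> y l \<and> \<not> trial_success L m y l) \<le> (1 - visit_prob (\<lambda>s. s) L 0 m) ^ N"
  using assms(2)
proof (induction n arbitrary: y v N rule: less_induct)
  case (less n)
  let ?p = "visit_prob (\<lambda>s. s) L 0 m"
  let ?F = "\<lambda>v y l. v \<le> visits \<phi> y l \<and> \<not> trial_success L m y l"
  show ?case
  proof (cases N)
    case 0
    then show ?thesis by (simp add: Pr_le_1)
  next
    case (Suc N')
    have p: "0 \<le> 1 - ?p" by (simp add: visit_prob_le_1)
    show ?thesis
    proof (cases "n < v")
      case True
      have "Pr n (?F v y) \<le> Pr n (\<lambda>_. False)"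
      proof (rule Pr_mono)
        fix l assume "l \<in> paths n" "?F v y l"
        then show False using True visits_le_length[of \<phi> y l] by (simp add: paths_def)
      qed
      also have "\<dots> \<le> (1 - ?p) ^ N" using zero_le_power[OF p, of N] by (simp only: Pr_const of_bool_eq)
      finally show ?thesis .
    next
      case n: False
      show ?thesis
      proof (cases "y = 0")
        case True
        \<comment> \<open>In the kernel: run one trial, then continue from wherever it ends.\<close>
        have v: "N' * Suc L \<le> v - L" "L \<le> v" using less.prems Suc by auto
        define n' where "n' = n - L"
        have n': "n = L + n'" "n' < n" using n v \<open>0 < L\<close> by (simp_all add: n'_def)
        have "Pr n (?F v y) = E L (\<lambda>l. Pr n' (\<lambda>l'. ?F v 0 (l @ l')))"
          by (simp add: n'(1) True Pr_def E_append)
        also have "\<dots> \<le> E L (\<lambda>l. of_bool (\<not> m \<le> visits (\<lambda>s. s) 0 l) * (1 - ?p) ^ N')"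
        proof (rule E_mono)
          fix l assume l: "l \<in> paths L"
          show "Pr n' (\<lambda>l'. ?F v 0 (l @ l')) \<le> of_bool (\<not> m \<le> visits (\<lambda>s. s) 0 l) * (1 - ?p) ^ N'"
          proof (cases "m \<le> visits (\<lambda>s. s) 0 l")
            case m: True
            have "trial_success L m 0 (l @ l')" for l'
              unfolding trial_success_def using l m
              by (intro exI[of _ 0]) (auto simp: paths_def endpoint_simps)
            then show ?thesis using m by (simp add: Pr_const)
          next
            case m: False
            have "Pr n' (\<lambda>l'. ?F v 0 (l @ l')) \<le> Pr n' (?F (v - L) (endpoint l))"
            proof (rule Pr_mono)
              fix l' assume F: "?F v 0 (l @ l')"
              have "visits \<phi> 0 l \<le> L" using l visits_le_length[of \<phi> 0 l] by (simp add: paths_def)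
              then have "v - L \<le> visits \<phi> (endpoint l) l'"
                using F unfolding visits_append endpoint_def add_0 by linarith
              then show "?F (v - L) (endpoint l) l'"
                using F trial_success_append[of L m 0 l l'] by auto
            qed
            also have "\<dots> \<le> (1 - ?p) ^ N'"
              by (rule less.IH[OF n'(2)]) (use v in blast)
            finally show ?thesis using m by simp
          qed
        qed
        also have "\<dots> = (1 - ?p) ^ N"
          by (simp only: E_cmult_right Suc power_Suc)
            (simp add: Pr_not visit_prob_def flip: Pr_def)
        finally show ?thesis .
      next
        case y: False
        \<comment> \<open>Outside the kernel: take one step.\<close>
        then have v: "N * Suc L \<le> v" using less.prems by auto
        then have "0 < v" using Suc by auto
        then obtain n' where n': "n = Suc n'" using n by (cases n) auto
        have "Pr n (?F v y) \<le> avg (\<lambda>s. (1 - ?p) ^ N)"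
          unfolding n' Pr_Suc
        proof (rule avg_mono)
          fix s assume "s \<in> S"
          let ?v = "v - of_bool (y + \<phi> s = 0)"
          have "Pr n' (\<lambda>l. ?F v y (s # l)) \<le> Pr n' (?F ?v (y + \<phi> s))"
            using trial_success_Cons by (intro Pr_mono) (auto simp: of_bool_def)
          also have "\<dots> \<le> (1 - ?p) ^ N"
            by (rule less.IH) (use v n' \<open>0 < v\<close> in \<open>auto simp: of_bool_def\<close>)
          finally show "Pr n' (\<lambda>l. ?F v y (s # l)) \<le> (1 - ?p) ^ N" .
        qed
        then show ?thesis by (simp add: avg_const)
      qed
    qed
  qed
qed

lemma no_trial_success_prob_le:
  assumes "0 < L"
  shows "Pr n (\<lambda>l. \<not> trial_success L m 0 l) \<le>
    (1 - visit_prob \<phi> n 0 (N * Suc L)) + (1 - visit_prob (\<lambda>s. s) L 0 m) ^ N"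
proof -
  let ?v = "N * Suc L"
  have "Pr n (\<lambda>l. \<not> trial_success L m 0 l) \<le>
      Pr n (\<lambda>l. \<not> ?v \<le> visits \<phi> 0 l \<or> (?v \<le> visits \<phi> 0 l \<and> \<not> trial_success L m 0 l))"
    by (rule Pr_mono) blast
  also have "\<dots> \<le> Pr n (\<lambda>l. \<not> ?v \<le> visits \<phi> 0 l)
      + Pr n (\<lambda>l. ?v \<le> visits \<phi> 0 l \<and> \<not> trial_success L m 0 l)"
    by (rule Pr_disj_le)
  also have "Pr n (\<lambda>l. \<not> ?v \<le> visits \<phi> 0 l) = 1 - visit_prob \<phi> n 0 ?v"
    by (simp add: Pr_not visit_prob_def)
  also have "Pr n (\<lambda>l. ?v \<le> visits \<phi> 0 l \<and> \<not> trial_success L m 0 l)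
      \<le> (1 - visit_prob (\<lambda>s. s) L 0 m) ^ N"
    by (rule all_trials_fail_prob_le[OF assms]) simp
  finally show ?thesis by simp
qed

end

section \<open>Transience in dimension at least three\<close>

definition unit_steps :: "(int ^ 'd) set" where
  "unit_steps = range (\<lambda>i. axis i 1) \<union> range (\<lambda>i. - axis i 1)"

text \<open>
  The linear form whose kernel is \<^const>\<open>int_hyperplane\<close>.
\<close>

definition hyperplane_form :: "int ^ 'd \<Rightarrow> int ^ 'd \<Rightarrow> int" where
  "hyperplane_form a x = (\<Sum>i\<in>UNIV. a $ i * x $ i)"

lemma axis_neq_minus_axis: "axis i (1::int) \<noteq> - axis j 1"
proof
  assume "axis i (1::int) = - axis j 1"
  then have "axis i (1::int) $ i = (- axis j 1) $ i" by simp
  then show False by (simp add: axis_def split: if_splits)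
qed

lemma sum_unit_steps:
  "(\<Sum>s\<in>unit_steps. F s) = (\<Sum>i\<in>UNIV. F (axis i 1) + F (- axis i 1 :: int ^ 'd))"
proof -
  let ?e = "\<lambda>i. axis i 1 :: int ^ 'd"
  have "inj ?e" "inj (\<lambda>i. - ?e i)"
    by (auto simp: inj_on_def axis_eq_axis)
  moreover have "range ?e \<inter> range (\<lambda>i. - ?e i) = {}"
    using axis_neq_minus_axis by blast
  ultimately show ?thesis
    unfolding unit_steps_def by (simp add: sum.union_disjoint sum.reindex sum.distrib)
qed

lemma card_unit_steps: "card (unit_steps :: (int ^ 'd) set) = 2 * CARD('d)"
  using sum_unit_steps[of "\<lambda>_ :: int ^ 'd. 1::nat"] by simp

interpretation lattice: uniform_steps "unit_steps :: (int ^ 'd) set"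
  by unfold_locales (auto simp: unit_steps_def)

lemma lattice_avg:
  "lattice.avg F = (\<Sum>i\<in>UNIV. F (axis i 1) + F (- axis i 1 :: int ^ 'd)) / (2 * real CARD('d))"
  by (simp add: lattice.avg_def sum_unit_steps card_unit_steps)

lemma hyperplane_form_axis: "hyperplane_form a (axis i 1) = a $ i"
  by (simp add: hyperplane_form_def axis_def if_distrib cong: if_cong)

lemma hyperplane_form_add: "hyperplane_form a (x + y) = hyperplane_form a x + hyperplane_form a y"
  by (simp add: hyperplane_form_def distrib_left sum.distrib)

lemma hyperplane_form_uminus: "hyperplane_form a (- x) = - hyperplane_form a x"
  by (simp add: hyperplane_form_def sum_negf)

lemma hyperplane_form_0: "hyperplane_form a 0 = 0"
  by (simp add: hyperplane_form_def)

lemma symmetric_steps_hyperplane_form: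
  assumes "a \<noteq> 0"
  shows "symmetric_steps unit_steps (hyperplane_form a)"
proof
  fix s :: "int ^ 'a" assume "s \<in> unit_steps"
  then show "- s \<in> unit_steps" by (auto simp: unit_steps_def)
next
  obtain i where "a $ i \<noteq> 0" using assms by (auto simp: vec_eq_iff)
  then show "\<exists>s\<in>unit_steps. hyperplane_form a s \<noteq> 0"
    by (intro bexI[of _ "axis i 1"]) (auto simp: hyperplane_form_axis unit_steps_def)
qed (simp add: hyperplane_form_uminus)

definition norm2 :: "int ^ 'd \<Rightarrow> real" where
  "norm2 x = (\<Sum>i\<in>UNIV. (real_of_int (x $ i))\<^sup>2)"

lemma norm2_add_axis:
  "norm2 (x + axis i 1) = norm2 x + 1 + 2 * real_of_int (x $ i)" (is ?plus)
  "norm2 (x - axis i 1) = norm2 x + 1 - 2 * real_of_int (x $ i)" (is ?minus)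
proof -
  have "norm2 (x + axis i 1) =
      (\<Sum>j\<in>UNIV. (real_of_int (x $ j))\<^sup>2 + (if j = i then 1 + 2 * real_of_int (x $ i) else 0))"
    unfolding norm2_def by (rule sum.cong) (auto simp: axis_def power2_eq_square algebra_simps)
  then show ?plus by (simp add: norm2_def sum.distrib)
  have "norm2 (x - axis i 1) =
      (\<Sum>j\<in>UNIV. (real_of_int (x $ j))\<^sup>2 + (if j = i then 1 - 2 * real_of_int (x $ i) else 0))"
    unfolding norm2_def by (rule sum.cong) (auto simp: axis_def power2_eq_square algebra_simps)
  then show ?minus by (simp add: norm2_def sum.distrib)
qed

text \<open>
  Taylor expansion at \<open>s\<close>, with the true coefficient \<open>5/32\<close> of the quadratic term relaxed to
  \<open>3/16 = 6/32\<close>. The second derivative of \<open>y powr (- 1/4)\<close> is decreasing, and for \<open>s \<ge> 1296 = 36\<^sup>2\<close>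
  the points considered are above \<open>17/18 * s\<close>, where it exceeds its value at \<open>s\<close> by a factor of at
  most \<open>(18/17) ^ 3 \<le> 6/5\<close>.
\<close>

lemma powr_quarter_quadratic_bound:
  fixes s v :: real
  assumes s: "1296 \<le> s" and v: "\<bar>v\<bar> \<le> 2 * sqrt s"
  shows "(s + v) powr (-1/4) \<le>
    s powr (-1/4) - 1/4 * s powr (-5/4) * v + 3/16 * s powr (-9/4) * v\<^sup>2"
proof (cases "v = 0")
  case False
  define d :: "nat \<Rightarrow> real \<Rightarrow> real" where
    "d m y = (if m = 0 then y powr (-1/4) else if m = 1 then -1/4 * y powr (-5/4)
      else 5/16 * y powr (-9/4))" for m y
  have "36 \<le> sqrt s" using real_sqrt_le_mono[OF s] by simp
  then have "36 * sqrt s \<le> sqrt s * sqrt s" by (intro mult_right_mono) (use s in auto)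
  then have low: "17/18 * s \<le> s - 2 * sqrt s" using s by simp
  have "\<forall>m t. m < 2 \<and> 17/18 * s \<le> t \<and> t \<le> s + 2 * sqrt s \<longrightarrow> (d m has_real_derivative d (Suc m) t) (at t)"
  proof (intro allI impI)
    fix m :: nat and t :: real
    assume "m < 2 \<and> 17/18 * s \<le> t \<and> t \<le> s + 2 * sqrt s"
    then have "0 < t" "m = 0 \<or> m = 1" using s by auto
    then show "(d m has_real_derivative d (Suc m) t) (at t)"
      unfolding d_def by (auto intro!: derivative_eq_intros)
  qed
  moreover have d0: "d 0 = (\<lambda>y. y powr (-1/4))" by (simp add: d_def fun_eq_iff)
  ultimately obtain t where t: "if s + v < s then s + v < t \<and> t < s else s < t \<and> t < s + v"
    "(s + v) powr (-1/4) = (\<Sum>m<2. d m s / fact m * (s + v - s) ^ m) + d 2 t / fact 2 * (s + v - s)\<^sup>2"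
    using Taylor[of 2 d "\<lambda>y. y powr (-1/4)" "17/18 * s" "s + 2 * sqrt s" s "s + v"]
      v low s False d0 by fastforce
  have "17/18 * s \<le> t" using t(1) low v by (auto split: if_splits)
  then have "t powr (-9/4) \<le> (17/18 * s) powr (-9/4)"
    using s by (intro powr_mono2') auto
  also have "\<dots> = (17/18) powr (-9/4) * s powr (-9/4)"
    using s by (intro powr_mult)
  also have "\<dots> \<le> 6/5 * s powr (-9/4)"
  proof (rule mult_right_mono)
    have "(17/18 :: real) powr (-9/4) \<le> (17/18) powr (- 3)"
      by (rule powr_mono') auto
    also have "\<dots> = 1 / (17/18) ^ 3"
      by (simp add: powr_minus_divide)
    also have "\<dots> \<le> 6/5" by (simp add: power3_eq_cube)
    finally show "(17/18 :: real) powr (-9/4) \<le> 6/5" .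
  qed simp
  finally have "5/32 * t powr (-9/4) \<le> 3/16 * s powr (-9/4)" by simp
  then have "5/32 * t powr (-9/4) * v\<^sup>2 \<le> 3/16 * s powr (-9/4) * v\<^sup>2"
    by (rule mult_right_mono) simp
  moreover have "(s + v) powr (-1/4) =
      s powr (-1/4) - 1/4 * s powr (-5/4) * v + 5/32 * t powr (-9/4) * v\<^sup>2"
    using t(2) by (simp add: d_def numeral_2_eq_2)
  ultimately show ?thesis by linarith
qed simp

lemma powr_quarter_convex:
  fixes s :: real
  assumes "1 < s"
  shows "s powr (-1/4) + 1/4 * s powr (-5/4) \<le> (s - 1) powr (-1/4)"
proof -
  have "\<exists>z. s - 1 < z \<and> z < s \<and>
      s powr (-1/4) - (s - 1) powr (-1/4) = (s - (s - 1)) * (-1/4 * z powr (-5/4))"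
    using assms by (intro MVT2) (auto intro!: derivative_eq_intros)
  then obtain z where z: "s - 1 < z" "z < s"
    "s powr (-1/4) - (s - 1) powr (-1/4) = -1/4 * z powr (-5/4)" by auto
  have "s powr (-5/4) \<le> z powr (-5/4)"
    using z assms by (intro powr_mono2') auto
  then show ?thesis using z(3) by linarith
qed

text \<open>
  In dimension \<open>d\<close> a power \<open>\<bar>x\<bar> powr (- b)\<close> is superharmonic far from the origin for
  \<open>0 < b < d - 2\<close>. The exponent \<open>b = 1/2\<close> serves all \<open>d \<ge> 3\<close> with room to spare, and shifting
  \<open>\<bar>x\<bar>\<^sup>2\<close> by 1296 keeps the argument in the range where the lattice Laplacian is close to the
  continuous one, even at the origin.
\<close>

definition lyapunov :: "int ^ 'd \<Rightarrow> real" where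
  "lyapunov x = (norm2 x + 1296) powr (-1/4)"

text \<open>
  With \<open>s = \<bar>x\<bar>\<^sup>2 + 1297\<close> the arguments at the neighbours are \<open>s \<plusminus> 2 x\<^sub>i\<close>, and the one at \<open>x\<close>
  is \<open>s - 1\<close>. Averaged over the neighbours, the linear terms
  cancel and the quadratic terms give at most \<open>4/d * 3/16\<close> times
  \<open>s powr (- 5/4)\<close>; for \<open>d \<ge> 3\<close> this is at most \<open>1/4 * s powr (- 5/4)\<close>, which is what
  convexity yields for the passage from \<open>s\<close> to \<open>s - 1\<close>.
\<close>

lemma lyapunov_superharmonic:
  fixes x :: "int ^ 'd"
  assumes d: "3 \<le> CARD('d)"
  shows "lattice.avg (\<lambda>s. lyapunov (x + s)) \<le> lyapunov x"
proof -
  define s where "s = norm2 x + 1297"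
  have n: "0 \<le> norm2 x" by (simp add: norm2_def sum_nonneg)
  then have s: "1297 \<le> s" by (simp add: s_def)
  let ?K = "3/16 * s powr (-9/4)"
  have two_sided: "lyapunov (x + axis i 1) + lyapunov (x + - axis i 1)
      \<le> 2 * (s powr (-1/4)) + 8 * ?K * (real_of_int (x $ i))\<^sup>2" for i
  proof -
    let ?u = "2 * real_of_int (x $ i)"
    have "(real_of_int (x $ i))\<^sup>2 \<le> norm2 x"
      unfolding norm2_def by (rule member_le_sum) auto
    then have "(real_of_int (x $ i))\<^sup>2 \<le> s" by (simp add: s_def)
    then have "\<bar>real_of_int (x $ i)\<bar> \<le> sqrt s"
      using real_sqrt_le_mono by fastforce
    then have "\<bar>?u\<bar> \<le> 2 * sqrt s" "\<bar>- ?u\<bar> \<le> 2 * sqrt s" by auto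
    from this[THEN powr_quarter_quadratic_bound[rotated]] s
    have "(s + ?u) powr (-1/4) + (s - ?u) powr (-1/4) \<le> 2 * (s powr (-1/4)) + 2 * ?K * ?u\<^sup>2"
      by simp
    moreover have "lyapunov (x + axis i 1) = (s + ?u) powr (-1/4)"
      "lyapunov (x + - axis i 1) = (s - ?u) powr (-1/4)"
      by (simp_all add: lyapunov_def s_def norm2_add_axis algebra_simps)
    ultimately show ?thesis by (simp add: power2_eq_square mult_ac)
  qed
  let ?d = "real CARD('d)"
  have "lattice.avg (\<lambda>s. lyapunov (x + s)) \<le>
      (\<Sum>i\<in>(UNIV::'d set). 2 * (s powr (-1/4)) + 8 * ?K * (real_of_int (x $ i))\<^sup>2) / (2 * ?d)"
    unfolding lattice_avg by (intro divide_right_mono sum_mono two_sided) auto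
  also have "\<dots> = s powr (-1/4) + 4 * ?K * norm2 x / ?d"
    unfolding sum.distrib sum_distrib_left[symmetric] norm2_def[symmetric]
    by (simp add: add_divide_distrib)
  also have "\<dots> \<le> s powr (-1/4) + 4 * ?K * s / 3"
  proof -
    have "4 * ?K * norm2 x / ?d \<le> 4 * ?K * s / 3"
      using d n by (intro frac_le mult_left_mono) (auto simp: s_def)
    then show ?thesis by simp
  qed
  also have "\<dots> = s powr (-1/4) + 1/4 * s powr (-5/4)"
  proof -
    have "s powr (-9/4) * s = s powr (-5/4)"
      using powr_add[of s "-9/4" 1] s by simp
    then show ?thesis by (simp add: mult.assoc)
  qed
  also have "\<dots> \<le> (s - 1) powr (-1/4)"
    using s by (intro powr_quarter_convex) auto
  also have "\<dots> = lyapunov x" by (simp add: lyapunov_def s_def add.commute)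
  finally show ?thesis .
qed

lemma lyapunov_pos: "0 < lyapunov x"
proof -
  have "0 \<le> norm2 x" by (simp add: norm2_def sum_nonneg)
  then show ?thesis by (simp add: lyapunov_def)
qed

text \<open>
  Maximum principle: along the walk stopped at the origin the Lyapunov function is a nonnegative
  supermartingale.
\<close>

lemma hitting_prob_le_lyapunov:
  fixes x :: "int ^ 'd"
  assumes d: "3 \<le> CARD('d)"
  shows "lattice.visit_prob (\<lambda>s. s) n x 1 * lyapunov (0 :: int ^ 'd) \<le> lyapunov x"
proof (induction n arbitrary: x)
  case 0
  show ?case using lyapunov_pos[of x]
    by (simp add: lattice.visit_prob_time_0_1 del: One_nat_def)
next
  case (Suc n)
  have "lattice.visit_prob (\<lambda>s. s) (Suc n) x 1 * lyapunov (0 :: int ^ 'd) =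
      lattice.avg (\<lambda>s. (if x + s = 0 then 1 else lattice.visit_prob (\<lambda>s. s) n (x + s) 1)
        * lyapunov (0 :: int ^ 'd))"
    by (simp only: lattice.visit_prob_Suc_1 lattice.avg_cmult_right)
  also have "\<dots> \<le> lattice.avg (\<lambda>s. lyapunov (x + s))"
  proof (rule lattice.avg_mono)
    fix s :: "int ^ 'd"
    show "(if x + s = 0 then 1 else lattice.visit_prob (\<lambda>s. s) n (x + s) 1)
        * lyapunov (0 :: int ^ 'd) \<le> lyapunov (x + s)"
      using Suc[of "x + s"] by (cases "x + s = 0") simp_all
  qed
  also have "\<dots> \<le> lyapunov x" by (rule lyapunov_superharmonic[OF d])
  finally show ?case .
qed

text \<open>
  A return takes one step to a neighbour, where the Lyapunov function is strictly smaller than at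
  the origin, followed by a hit of the origin.
\<close>

lemma return_prob_bounded_away_from_1:
  assumes d: "3 \<le> CARD('d)"
  obtains r where "r < 1" "\<And>n. lattice.visit_prob (\<lambda>s. s) n (0 :: int ^ 'd) 1 \<le> r"
proof
  let ?r = "1297 powr (-1/4) / 1296 powr (-1/4) :: real"
  have r0: "0 < ?r" by simp
  show "?r < 1" by (simp add: powr_less_mono2_neg)
  fix n
  show "lattice.visit_prob (\<lambda>s. s) n (0 :: int ^ 'd) 1 \<le> ?r"
  proof (cases n)
    case 0
    then show ?thesis using r0 by (simp add: lattice.visit_prob_time_0_1 del: One_nat_def)
  next
    case (Suc n')
    have "lattice.visit_prob (\<lambda>s. s) n (0 :: int ^ 'd) 1 \<le> lattice.avg (\<lambda>_ :: int ^ 'd. ?r)"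
      unfolding Suc lattice.visit_prob_Suc_1
    proof (rule lattice.avg_mono)
      fix s :: "int ^ 'd" assume "s \<in> unit_steps"
      then obtain i where i: "s = axis i 1 \<or> s = - axis i 1" by (auto simp: unit_steps_def)
      then have "s \<noteq> 0" by auto
      have "norm2 (0 :: int ^ 'd) = 0" by (simp add: norm2_def)
      then have "norm2 s = 1" using i norm2_add_axis[of 0 i] by auto
      then have "lyapunov s = 1297 powr (-1/4)" "lyapunov (0 :: int ^ 'd) = 1296 powr (-1/4)"
        using \<open>norm2 (0 :: int ^ 'd) = 0\<close> by (simp_all add: lyapunov_def)
      then have "lattice.visit_prob (\<lambda>s. s) n' s 1 \<le> ?r"
        using hitting_prob_le_lyapunov[OF d, of n' s] by (simp add: field_simps)
      then show "(if 0 + s = 0 then 1 else lattice.visit_prob (\<lambda>s. s) n' (0 + s) 1) \<le> ?r"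
        using \<open>s \<noteq> 0\<close> by simp
    qed
    then show ?thesis by (simp add: lattice.avg_const)
  qed
qed

lemma return_prob_pos: "0 < lattice.visit_prob (\<lambda>s. s) 2 (0 :: int ^ 'd) 1"
proof -
  let ?i = "undefined :: 'd"
  let ?l = "[axis ?i 1, - axis ?i 1] :: (int ^ 'd) list"
  have "axis ?i 1 \<in> (unit_steps :: (int ^ 'd) set)" "- axis ?i 1 \<in> (unit_steps :: (int ^ 'd) set)"
    by (auto simp: unit_steps_def)
  then have l: "?l \<in> lattice.paths 2" by (simp add: lattice.paths_def)
  have "1 \<le> visits (\<lambda>s. s) 0 ?l" by simp
  then have "0 < (\<Sum>l\<in>lattice.paths 2. of_bool (1 \<le> visits (\<lambda>s. s) (0 :: int ^ 'd) l) :: real)"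
    by (intro sum_pos2[OF lattice.finite_paths l]) auto
  then show ?thesis
    unfolding lattice.visit_prob_def lattice.Pr_def lattice.E_def
    by (intro divide_pos_pos zero_less_power lattice.card_S_pos)
qed

section \<open>Path averages as probabilities\<close>

context simple_random_walk
begin

definition path :: "nat \<Rightarrow> 'a \<Rightarrow> (int ^ 'd) list" where
  "path n \<omega> = map (\<lambda>k. X k \<omega>) [1..<Suc n]"

lemma length_path: "length (path n \<omega>) = n"
  by (simp add: path_def)

lemma path_Suc: "path (Suc n) \<omega> = path n \<omega> @ [X (Suc n) \<omega>]"
  by (simp add: path_def)

lemma walk_eq_sum_list:
  assumes "k \<le> n"
  shows "walk X k \<omega> = sum_list (take k (path n \<omega>))"
proof -
  have "take k (path n \<omega>) = path k \<omega>"
    using assms by (simp add: path_def take_map del: upt_Suc)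
  moreover have "sum_list (path k \<omega>) = walk X k \<omega>"
    by (induction k) (simp_all add: path_Suc walk_def, simp add: path_def)
  ultimately show ?thesis by simp
qed

lemma local_time_eq_visits: "local_time X x n \<omega> = visits (\<lambda>s. s) (- x) (path n \<omega>)"
proof -
  have "- x + sum_list (take k (path n \<omega>)) = 0 \<longleftrightarrow> walk X k \<omega> = x" if "k \<le> n" for k
    using walk_eq_sum_list[OF that] by (simp add: add_eq_0_iff)
  then have "{k. 0 < k \<and> k \<le> n \<and> walk X k \<omega> = x} =
      {k. 0 < k \<and> k \<le> n \<and> - x + sum_list (take k (path n \<omega>)) = 0}" by blast
  then show ?thesis by (simp add: visits_eq_card local_time_def length_path)
qed

lemma path_event_measurable: "{\<omega> \<in> space M. Q (path n \<omega>)} \<in> events"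
proof (induction n arbitrary: Q)
  case 0
  then show ?case by (cases "Q []") (simp_all add: path_def)
next
  case (Suc n)
  have X: "{\<omega> \<in> space M. X (Suc n) \<omega> = s} \<in> events" for s
  proof -
    have "random_variable (count_space UNIV) (X (Suc n))"
      using indep_steps by (auto simp: indep_vars_def)
    from measurable_sets[OF this, of "{s}"] show ?thesis
      by (simp add: vimage_def Int_def conj_commute)
  qed
  have "{\<omega> \<in> space M. Q (path (Suc n) \<omega>)} =
      (\<Union>s. {\<omega> \<in> space M. X (Suc n) \<omega> = s} \<inter> {\<omega> \<in> space M. Q (path n \<omega> @ [s])})"
    by (auto simp: path_Suc)
  also have "\<dots> \<in> events"
    using Suc[of "\<lambda>l. Q (l @ [_])"] X by (intro sets.countable_UN') auto
  finally show ?case .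
qed

lemma prob_cylinder:
  assumes l: "l \<in> lattice.paths n"
  shows "prob {\<omega> \<in> space M. path n \<omega> = l} = 1 / real (card (unit_steps :: (int ^ 'd) set)) ^ n"
proof (cases "n = 0")
  case True
  then have "{\<omega> \<in> space M. path n \<omega> = l} = space M"
    using l by (auto simp: path_def lattice.paths_def)
  then show ?thesis using True by (simp add: prob_space)
next
  case False
  have len: "length l = n" and set_l: "set l \<subseteq> unit_steps" using l by (auto simp: lattice.paths_def)
  have "{\<omega> \<in> space M. path n \<omega> = l} = (\<Inter>k\<in>{1..n}. X k -` {l ! (k - 1)} \<inter> space M)"
  proof -
    have "path n \<omega> = l \<longleftrightarrow> (\<forall>k\<in>{1..n}. X k \<omega> = l ! (k - 1))" for \<omega>
    proof -
      have "path n \<omega> = l \<longleftrightarrow> (\<forall>i<n. X (Suc i) \<omega> = l ! i)"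
        by (simp add: list_eq_iff_nth_eq len path_def del: upt_Suc)
      also have "\<dots> \<longleftrightarrow> (\<forall>k\<in>{1..n}. X k \<omega> = l ! (k - 1))"
      proof (intro iffI ballI allI impI)
        fix k assume "\<forall>i<n. X (Suc i) \<omega> = l ! i" "k \<in> {1..n}"
        then show "X k \<omega> = l ! (k - 1)" by (cases k) auto
      next
        fix i assume "\<forall>k\<in>{1..n}. X k \<omega> = l ! (k - 1)" "i < n"
        then show "X (Suc i) \<omega> = l ! i" by (drule_tac bspec[of _ _ "Suc i"]) auto
      qed
      finally show ?thesis .
    qed
    moreover have "(1::nat) \<in> {1..n}" using False by auto
    ultimately show ?thesis by auto
  qed
  also have "prob \<dots> = (\<Prod>k\<in>{1..n}. prob (X k -` {l ! (k - 1)} \<inter> space M))"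
    using False by (intro indep_varsD[OF indep_steps]) auto
  also have "\<dots> = (\<Prod>k\<in>{1..n}. 1 / real (card (unit_steps :: (int ^ 'd) set)))"
  proof (rule prod.cong)
    fix k assume k: "k \<in> {1..n}"
    then have "l ! (k - 1) \<in> set l" using len by (intro nth_mem) auto
    then have "l ! (k - 1) \<in> unit_steps" using set_l by blast
    then obtain i where "l ! (k - 1) = axis i 1 \<or> l ! (k - 1) = - axis i 1"
      by (auto simp: unit_steps_def)
    moreover have "X k -` {s} \<inter> space M = {\<omega> \<in> space M. X k \<omega> = s}" for s by auto
    ultimately show "prob (X k -` {l ! (k - 1)} \<inter> space M)
        = 1 / real (card (unit_steps :: (int ^ 'd) set))"
      using k prob_step_pos[of k i] prob_step_neg[of k i] by (auto simp: card_unit_steps)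
  qed simp
  finally show ?thesis by (simp add: power_divide)
qed

text \<open>
  The event contains the disjoint cylinders of those paths of unit steps that satisfy \<open>Q\<close>. Applied
  to \<open>Q\<close> and to its negation, this inequality already forces equality.
\<close>

lemma prob_path_event_ge: "lattice.Pr n Q \<le> prob {\<omega> \<in> space M. Q (path n \<omega>)}"
proof -
  let ?P = "{l \<in> lattice.paths n. Q l}"
  have fin: "finite ?P" by (rule finite_subset[OF _ lattice.finite_paths]) auto
  have "lattice.Pr n Q = (\<Sum>l\<in>?P. 1 / real (card (unit_steps :: (int ^ 'd) set)) ^ n)"
    by (simp add: lattice.Pr_def lattice.E_def of_bool_def
        flip: sum.inter_filter[OF lattice.finite_paths])
  also have "\<dots> = (\<Sum>l\<in>?P. prob {\<omega> \<in> space M. path n \<omega> = l})"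
    by (intro sum.cong) (auto simp: prob_cylinder)
  also have "\<dots> = prob (\<Union>l\<in>?P. {\<omega> \<in> space M. path n \<omega> = l})"
    using path_event_measurable[of "\<lambda>l'. l' = _"] fin
    by (intro finite_measure_finite_Union[symmetric]) (auto simp: disjoint_family_on_def)
  also have "\<dots> \<le> prob {\<omega> \<in> space M. Q (path n \<omega>)}"
    by (intro finite_measure_mono path_event_measurable) auto
  finally show ?thesis .
qed

lemma prob_path_event: "prob {\<omega> \<in> space M. Q (path n \<omega>)} = lattice.Pr n Q"
proof (rule antisym)
  have "{\<omega> \<in> space M. \<not> Q (path n \<omega>)} = space M - {\<omega> \<in> space M. Q (path n \<omega>)}" by auto
  then have "prob {\<omega> \<in> space M. \<not> Q (path n \<omega>)} = 1 - prob {\<omega> \<in> space M. Q (path n \<omega>)}"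
    using path_event_measurable by (simp add: prob_compl)
  then show "prob {\<omega> \<in> space M. Q (path n \<omega>)} \<le> lattice.Pr n Q"
    using prob_path_event_ge[of n "\<lambda>l. \<not> Q l"] by (simp add: lattice.Pr_not)
qed (rule prob_path_event_ge)

definition return_prob :: real where
  "return_prob = 1 - escape_prob M X"

text \<open>
  Continuity from above: never returning is the decreasing limit of not returning by time \<open>n\<close>.
\<close>

lemma visit_prob_tendsto_return_prob:
  "(\<lambda>n. lattice.visit_prob (\<lambda>s. s) n (0 :: int ^ 'd) 1) \<longlonglongrightarrow> return_prob"
proof -
  let ?A = "\<lambda>n. {\<omega> \<in> space M. \<not> 1 \<le> visits (\<lambda>s. s) 0 (path n \<omega>)}"
  have A: "?A n = {\<omega> \<in> space M. \<forall>k. 0 < k \<and> k \<le> n \<longrightarrow> walk X k \<omega> \<noteq> 0}" for n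
  proof -
    have "\<not> 1 \<le> visits (\<lambda>s. s) 0 (path n \<omega>) \<longleftrightarrow> (\<forall>k. 0 < k \<and> k \<le> n \<longrightarrow> walk X k \<omega> \<noteq> 0)" for \<omega>
    proof -
      have "\<not> 1 \<le> visits (\<lambda>s. s) 0 (path n \<omega>) \<longleftrightarrow> local_time X 0 n \<omega> = 0"
        by (auto simp: local_time_eq_visits)
      also have "\<dots> \<longleftrightarrow> {k. 0 < k \<and> k \<le> n \<and> walk X k \<omega> = 0} = {}"
        unfolding local_time_def by (rule card_0_eq) simp
      finally show ?thesis by blast
    qed
    then show ?thesis by blast
  qed
  have "decseq ?A" unfolding A decseq_def by auto
  moreover have "range ?A \<subseteq> events"
    using path_event_measurable[of "\<lambda>l. \<not> 1 \<le> visits (\<lambda>s. s) 0 l"] by blast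
  ultimately have "(\<lambda>n. prob (?A n)) \<longlonglongrightarrow> prob (\<Inter>n. ?A n)"
    by (intro finite_Lim_measure_decseq)
  moreover have "(\<Inter>n. ?A n) = {\<omega> \<in> space M. \<forall>k\<ge>1. walk X k \<omega> \<noteq> 0}"
    unfolding A by (auto simp: Suc_le_eq)
  moreover have "prob (?A n) = 1 - lattice.visit_prob (\<lambda>s. s) n (0 :: int ^ 'd) 1" for n
    using prob_path_event[of "\<lambda>l. \<not> 1 \<le> visits (\<lambda>s. s) 0 l" n]
    by (simp only: lattice.Pr_not lattice.visit_prob_def)
  ultimately have "(\<lambda>n. 1 - lattice.visit_prob (\<lambda>s. s) n (0 :: int ^ 'd) 1) \<longlonglongrightarrow> escape_prob M X"
    by (simp only: escape_prob_def)
  from tendsto_diff[OF tendsto_const[of 1] this] show ?thesis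
    by (simp add: return_prob_def)
qed

lemma visit_prob_le_return_prob:
  "lattice.visit_prob (\<lambda>s. s) n (0 :: int ^ 'd) 1 \<le> return_prob"
  by (rule incseq_le[OF _ visit_prob_tendsto_return_prob])
    (simp add: incseq_def lattice.visit_prob_mono_time)

lemma return_prob_bounds:
  assumes "3 \<le> CARD('d)"
  shows "0 < return_prob" "return_prob < 1"
proof -
  show "0 < return_prob"
    using return_prob_pos visit_prob_le_return_prob[of 2] by (rule less_le_trans)
  obtain r where "r < 1" "\<And>n. lattice.visit_prob (\<lambda>s. s) n (0 :: int ^ 'd) 1 \<le> r"
    using return_prob_bounded_away_from_1[OF assms] by blast
  then show "return_prob < 1"
    using LIMSEQ_le_const2[OF visit_prob_tendsto_return_prob, of r] by force
qed

lemma lambda_const_eq: "lambda_const M X = - 1 / ln return_prob"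
  by (simp add: lambda_const_def return_prob_def)

lemma le_max_local_time_iff:
  "m \<le> max_local_time X (int_hyperplane a) n \<omega> \<longleftrightarrow>
    (\<exists>x. hyperplane_form a x = 0 \<and> m \<le> visits (\<lambda>s. s) (- x) (path n \<omega>))"
proof -
  let ?T = "(\<lambda>x. local_time X x n \<omega>) ` int_hyperplane a"
  have "?T \<subseteq> {..n}"
    using visits_le_length[of "\<lambda>s. s" _ "path n \<omega>"] by (auto simp: local_time_eq_visits length_path)
  then have "finite ?T" by (rule finite_subset) simp
  moreover have "0 \<in> int_hyperplane a" by (simp add: int_hyperplane_def)
  then have "?T \<noteq> {}" by blast
  ultimately have "m \<le> Max ?T \<longleftrightarrow> (\<exists>t\<in>?T. m \<le> t)" by (rule Max_ge_iff)
  then show ?thesis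
    by (auto simp: max_local_time_def local_time_eq_visits int_hyperplane_def hyperplane_form_def)
qed

lemma max_local_time_mono:
  assumes "n \<le> n'"
  shows "max_local_time X (int_hyperplane a) n \<omega> \<le> max_local_time X (int_hyperplane a) n' \<omega>"
proof -
  let ?m = "max_local_time X (int_hyperplane a) n \<omega>"
  obtain x where x: "hyperplane_form a x = 0" "?m \<le> visits (\<lambda>s. s) (- x) (path n \<omega>)"
    using le_max_local_time_iff[of ?m a n \<omega>] by auto
  have "{k. 0 < k \<and> k \<le> n \<and> walk X k \<omega> = x} \<subseteq> {k. 0 < k \<and> k \<le> n' \<and> walk X k \<omega> = x}"
    using assms by auto
  then have "local_time X x n \<omega> \<le> local_time X x n' \<omega>"
    unfolding local_time_def by (rule card_mono[rotated]) auto
  then show ?thesis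
    using x by (subst le_max_local_time_iff) (auto simp: local_time_eq_visits)
qed

lemma prob_max_local_time_ge:
  assumes "a \<noteq> 0"
  shows "prob {\<omega> \<in> space M. Suc m \<le> max_local_time X (int_hyperplane a) n \<omega>}
    \<le> return_prob ^ m * (\<Sum>k=1..n. lattice.zero_prob (hyperplane_form a) k 0)"
proof -
  interpret symmetric_steps unit_steps "hyperplane_form a" by (rule symmetric_steps_hyperplane_form[OF assms])
  have "lattice.visit_prob (\<lambda>s. s) n (0 :: int ^ 'd) m \<le> return_prob ^ m" for n
    by (rule order_trans[OF lattice.visit_prob_le_power
          power_mono[OF visit_prob_le_return_prob lattice.visit_prob_ge_0]])
  then have "lattice.Pr n (\<lambda>l. \<exists>x. 0 + hyperplane_form a x = 0 \<and> Suc m \<le> visits (\<lambda>s. s) (- x) l)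
    \<le> return_prob ^ m * (\<Sum>k=1..n. lattice.zero_prob (hyperplane_form a) k 0)"
    by (intro popular_zero_point_prob_le) (auto simp: hyperplane_form_add)
  then show ?thesis
    using prob_path_event[of "\<lambda>l. \<exists>x. hyperplane_form a x = 0 \<and> Suc m \<le> visits (\<lambda>s. s) (- x) l" n]
    unfolding le_max_local_time_iff by simp
qed

text \<open>
  A successful trial that starts in the hyperplane makes its starting point popular.
\<close>

lemma prob_max_local_time_less:
  assumes "a \<noteq> 0" and "0 < L"
  shows "prob {\<omega> \<in> space M. \<not> m \<le> max_local_time X (int_hyperplane a) n \<omega>}
    \<le> (1 - lattice.visit_prob (hyperplane_form a) n 0 (N * Suc L))
      + (1 - lattice.visit_prob (\<lambda>s. s) L (0 :: int ^ 'd) m) ^ N"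
proof -
  interpret symmetric_steps unit_steps "hyperplane_form a" by (rule symmetric_steps_hyperplane_form[OF assms(1)])
  have endpoint: "endpoint l = hyperplane_form a (sum_list l)" for l
    by (induction l) (simp_all add: endpoint_simps hyperplane_form_0 hyperplane_form_add)
  have "\<exists>x. hyperplane_form a x = 0 \<and> m \<le> visits (\<lambda>s. s) (- x) l" if "trial_success L m 0 l" for l
  proof -
    from that obtain k where k: "hyperplane_form a (sum_list (take k l)) = 0"
      "m \<le> visits (\<lambda>s. s) 0 (take L (drop k l))"
      by (auto simp: trial_success_def endpoint)
    let ?x = "sum_list (take k l)"
    have "l = take k l @ take L (drop k l) @ drop L (drop k l)" by (metis append_take_drop_id)
    then have "visits (\<lambda>s. s) (- ?x) l = visits (\<lambda>s. s) (- ?x) (take k l @ take L (drop k l) @ drop L (drop k l))"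
      by simp
    also have "\<dots> \<ge> visits (\<lambda>s. s) 0 (take L (drop k l))"
      by (simp only: visits_append) simp
    finally show ?thesis using k by auto
  qed
  then have "lattice.Pr n (\<lambda>l. \<not> (\<exists>x. hyperplane_form a x = 0 \<and> m \<le> visits (\<lambda>s. s) (- x) l))
      \<le> lattice.Pr n (\<lambda>l. \<not> trial_success L m 0 l)"
    by (intro lattice.Pr_mono) blast
  also have "\<dots> \<le> (1 - lattice.visit_prob (hyperplane_form a) n 0 (N * Suc L)) + (1 - lattice.visit_prob (\<lambda>s. s) L (0 :: int ^ 'd) m) ^ N"
    by (rule no_trial_success_prob_le[OF assms(2)])
  finally show ?thesis
    unfolding le_max_local_time_iff
      prob_path_event[of "\<lambda>l. \<not> (\<exists>x. hyperplane_form a x = 0 \<and> m \<le> visits (\<lambda>s. s) (- x) l)" n] .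
qed

end

section \<open>Almost sure growth\<close>

text \<open>
  Passing to the next power of two changes \<open>c * ln n\<close> only by a bounded amount, which the gap
  between \<open>c\<close> and \<open>c'\<close> absorbs.
\<close>

lemma dyadic_upper_interpolation:
  fixes f :: "nat \<Rightarrow> real"
  assumes "mono f" and c: "0 \<le> c" "c < c'"
    and dyadic: "\<forall>\<^sub>F j in sequentially. f (2 ^ j) \<le> c * (real j * ln 2) + 2"
  shows "\<forall>\<^sub>F n in sequentially. f n / ln (real n) < c'"
proof -
  obtain J where J: "\<And>j. J \<le> j \<Longrightarrow> f (2 ^ j) \<le> c * (real j * ln 2) + 2"
    using dyadic by (auto simp: eventually_sequentially)
  have lim: "filterlim (\<lambda>n. ln (real n)) at_top sequentially"
    by (rule filterlim_compose[OF ln_at_top filterlim_real_sequentially])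
  have "\<forall>\<^sub>F n in sequentially. (c * ln 2 + 3) / (c' - c) \<le> ln (real n)"
    using lim by (auto simp: filterlim_at_top)
  then show ?thesis
    using eventually_ge_at_top[of "2 ^ Suc J"] eventually_gt_at_top[of 1]
  proof eventually_elim
    case (elim n)
    obtain j where j: "2 ^ j \<le> n" "n < 2 ^ (j + 1)"
      using ex_power_ivl1[of 2 n] elim by auto
    have "(2::nat) ^ Suc J < 2 ^ (j + 1)" using elim j by linarith
    then have "J \<le> j + 1" by (subst (asm) power_strict_increasing_iff) auto
    have "real j * ln 2 = ln (2 ^ j)" by (simp add: ln_realpow)
    also have "\<dots> \<le> ln (real n)"
    proof (subst ln_le_cancel_iff)
      have "real (2 ^ j) \<le> real n" using j(1) by (simp only: of_nat_le_iff)
      then show "2 ^ j \<le> real n" by simp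
    qed (use elim in auto)
    finally have "c * (real j * ln 2) \<le> c * ln (real n)" using c by (intro mult_left_mono) auto
    moreover have "f n \<le> f (2 ^ (j + 1))" using \<open>mono f\<close> j by (simp add: mono_def)
    moreover have "f (2 ^ (j + 1)) \<le> c * (real (j + 1) * ln 2) + 2" by (rule J) fact
    moreover have "c * (real (j + 1) * ln 2) = c * (real j * ln 2) + c * ln 2"
      by (simp add: algebra_simps)
    moreover have "c * ln 2 + 3 \<le> c' * ln (real n) - c * ln (real n)"
      using elim(1) c by (simp add: pos_divide_le_eq algebra_simps)
    ultimately have "f n < c' * ln (real n)" by linarith
    then show ?case using elim(3) by (simp add: pos_divide_less_eq)
  qed
qed

lemma dyadic_lower_interpolation:
  fixes f :: "nat \<Rightarrow> real"
  assumes "mono f" and c: "0 \<le> c" "c' < c"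
    and dyadic: "\<forall>\<^sub>F j in sequentially. c * (real j * ln 2) - 1 \<le> f (2 ^ j)"
  shows "\<forall>\<^sub>F n in sequentially. c' < f n / ln (real n)"
proof -
  obtain J where J: "\<And>j. J \<le> j \<Longrightarrow> c * (real j * ln 2) - 1 \<le> f (2 ^ j)"
    using dyadic by (auto simp: eventually_sequentially)
  have lim: "filterlim (\<lambda>n. ln (real n)) at_top sequentially"
    by (rule filterlim_compose[OF ln_at_top filterlim_real_sequentially])
  have "\<forall>\<^sub>F n in sequentially. (c * ln 2 + 2) / (c - c') \<le> ln (real n)"
    using lim by (auto simp: filterlim_at_top)
  then show ?thesis
    using eventually_ge_at_top[of "2 ^ J"] eventually_gt_at_top[of 1]
  proof eventually_elim
    case (elim n)
    obtain j where j: "2 ^ j \<le> n" "n < 2 ^ (j + 1)"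
      using ex_power_ivl1[of 2 n] elim by auto
    have "(2::nat) ^ J < 2 ^ (j + 1)" using elim j by linarith
    then have "J < j + 1" by (subst (asm) power_strict_increasing_iff) auto
    then have "J \<le> j" by simp
    have "ln (real n) \<le> ln (2 ^ (j + 1))"
    proof (subst ln_le_cancel_iff)
      have "real n < real (2 ^ (j + 1))" using j(2) by (simp only: of_nat_less_iff)
      then show "real n \<le> 2 ^ (j + 1)" by simp
    qed (use elim in auto)
    also have "\<dots> = real (j + 1) * ln 2" by (simp only: ln_realpow)
    finally have "c * ln (real n) \<le> c * (real (j + 1) * ln 2)" using c by (intro mult_left_mono) auto
    moreover have "f (2 ^ j) \<le> f n" using \<open>mono f\<close> j by (simp add: mono_def)
    moreover have "c * (real j * ln 2) - 1 \<le> f (2 ^ j)" by (rule J) fact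
    moreover have "c * (real (j + 1) * ln 2) = c * (real j * ln 2) + c * ln 2"
      by (simp add: algebra_simps)
    moreover have "c * ln 2 + 2 \<le> c * ln (real n) - c' * ln (real n)"
      using elim(1) c by (simp add: pos_divide_le_eq algebra_simps)
    ultimately have "c' * ln (real n) < f n" by linarith
    then show ?case using elim(3) by (simp add: pos_less_divide_eq)
  qed
qed

lemma power_ln_2_eq:
  assumes "0 < r"
  shows "r powr (c * (real j * ln 2)) = (2 powr (c * ln r)) ^ j"
proof -
  have "(2 powr (c * ln r)) ^ j = exp (real j * (c * ln r * ln 2))"
    by (simp only: exp_of_nat_mult) (simp add: powr_def)
  also have "\<dots> = r powr (c * (real j * ln 2))"
    using assms by (simp add: powr_def mult_ac)
  finally show ?thesis ..
qed

context simple_random_walk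
begin

text \<open>
  For \<open>n = 2 ^ j\<close> and \<open>m\<close> about \<open>c * ln n\<close> the union bound is of order
  \<open>sqrt n * n powr (c * ln q)\<close>, which decays geometrically in \<open>j\<close> because \<open>c * ln q < - 1/2\<close>.
\<close>

lemma max_local_time_upper:
  assumes a: "a \<noteq> 0" and d: "3 \<le> CARD('d)"
    and c: "0 < c" "c * ln return_prob < - 1/2" and c': "c < c'"
  shows "AE \<omega> in M. \<forall>\<^sub>F n in sequentially.
    real (max_local_time X (int_hyperplane a) n \<omega>) / ln (real n) < c'"
proof -
  note q = return_prob_bounds[OF d]
  define m where "m j = nat \<lceil>c * (real j * ln 2)\<rceil>" for j :: nat
  define B where "B j = {\<omega> \<in> space M. Suc (m j) \<le> max_local_time X (int_hyperplane a) (2 ^ j) \<omega>}" for j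
  have B: "B j \<in> events" for j
    unfolding B_def le_max_local_time_iff by (rule path_event_measurable)
  interpret symmetric_steps unit_steps "hyperplane_form a" by (rule symmetric_steps_hyperplane_form[OF a])
  obtain C where C: "0 < C" "\<And>n. (\<Sum>k<n. lattice.zero_prob (hyperplane_form a) k 0) \<le> C * sqrt (real n)"
    using green_upper_bound by blast
  define \<rho> where "\<rho> = 2 powr (c * ln return_prob + 1/2)"
  have \<rho>: "0 < \<rho>" "\<rho> < 1" using c unfolding \<rho>_def by (auto intro!: powr_less_one)
  have prob_B: "prob (B j) \<le> C * sqrt 2 * \<rho> ^ j" for j
  proof -
    have mj: "c * (real j * ln 2) \<le> real (m j)" unfolding m_def by linarith
    have "return_prob ^ m j = return_prob powr real (m j)" using q by (simp add: powr_realpow)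
    also have "\<dots> \<le> return_prob powr (c * (real j * ln 2))"
      using mj q by (intro powr_mono') auto
    also have "\<dots> = (2 powr (c * ln return_prob)) ^ j" by (rule power_ln_2_eq[OF q(1)])
    finally have q_m: "return_prob ^ m j \<le> (2 powr (c * ln return_prob)) ^ j" .
    have "(\<Sum>k=1..2 ^ j. lattice.zero_prob (hyperplane_form a) k 0) \<le> (\<Sum>k<2 ^ j + 1. lattice.zero_prob (hyperplane_form a) k 0)"
      by (rule sum_mono2) (auto simp: lattice.zero_prob_ge_0)
    also have "\<dots> \<le> C * sqrt (real (2 ^ j + 1))" by (rule C)
    also have "\<dots> \<le> C * sqrt (2 * 2 ^ j)"
      using C(1) by (intro mult_left_mono) auto
    also have "\<dots> = C * sqrt 2 * (2 powr (1/2)) ^ j"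
      unfolding real_sqrt_mult real_sqrt_power powr_half_sqrt[of 2, simplified] by simp
    finally have "return_prob ^ m j * (\<Sum>k=1..2 ^ j. lattice.zero_prob (hyperplane_form a) k 0)
        \<le> (2 powr (c * ln return_prob)) ^ j * (C * sqrt 2 * (2 powr (1/2)) ^ j)"
      using q_m by (intro mult_mono) (auto intro!: sum_nonneg lattice.zero_prob_ge_0)
    also have "\<dots> = C * sqrt 2 * \<rho> ^ j"
      unfolding \<rho>_def powr_add power_mult_distrib by (rule mult.left_commute)
    finally show ?thesis
      using prob_max_local_time_ge[OF a, of "m j" "2 ^ j"] unfolding B_def by linarith
  qed
  have "summable (\<lambda>j. prob (B j))"
  proof (rule summable_comparison_test')
    show "summable (\<lambda>j. C * sqrt 2 * \<rho> ^ j)"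
      using \<rho> by (intro summable_mult summable_geometric) auto
  qed (simp add: prob_B)
  then have "AE \<omega> in M. \<forall>\<^sub>F j in sequentially. \<omega> \<in> space M - B j"
    using B by (intro borel_cantelli_AE1) (auto simp: emeasure_eq_measure)
  then show ?thesis
  proof (rule AE_mp, intro AE_I2 impI)
    fix \<omega> assume \<omega>: "\<omega> \<in> space M" "\<forall>\<^sub>F j in sequentially. \<omega> \<in> space M - B j"
    show "\<forall>\<^sub>F n in sequentially. real (max_local_time X (int_hyperplane a) n \<omega>) / ln (real n) < c'"
    proof (rule dyadic_upper_interpolation)
      show "mono (\<lambda>n. real (max_local_time X (int_hyperplane a) n \<omega>))"
        by (simp add: mono_def max_local_time_mono)
      show "\<forall>\<^sub>F j in sequentially.
          real (max_local_time X (int_hyperplane a) (2 ^ j) \<omega>) \<le> c * (real j * ln 2) + 2"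
        using \<omega>(2)
      proof eventually_elim
        case (elim j)
        then have "max_local_time X (int_hyperplane a) (2 ^ j) \<omega> \<le> m j"
          using \<omega>(1) by (auto simp: B_def)
        moreover have "real (m j) \<le> c * (real j * ln 2) + 1"
        proof -
          have "0 \<le> c * (real j * ln 2)" using c(1) by simp
          then show ?thesis unfolding m_def by linarith
        qed
        ultimately show ?case by linarith
      qed
    qed (use c c' in auto)
  qed
qed

text \<open>
  Fix a horizon \<open>\<nu>\<close> so long that the probability \<open>r\<close> of returning within \<open>\<nu>\<close> steps still satisfies
  \<open>c * ln r > - 1/2\<close>. A trial of about \<open>\<nu> * m\<close> steps, with \<open>m\<close> about \<open>c * ln n\<close>, then succeeds with
  probability at least \<open>n powr (- \<beta>)\<close> for some \<open>\<beta> < 1/2\<close>. With \<open>n powr \<beta>'\<close> trials, where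
  \<open>\<beta> < \<beta>' < 1/2\<close>, one of them succeeds almost surely for large \<open>n = 2 ^ j\<close>, and there is time for
  all of them because they need only \<open>n powr \<beta>' * O(ln n)\<close> visits to the hyperplane, far fewer
  than \<open>sqrt n\<close>.
\<close>

lemma max_local_time_lower:
  assumes a: "a \<noteq> 0" and d: "3 \<le> CARD('d)"
    and c: "0 < c" "- 1/2 < c * ln return_prob" and c': "c' < c"
  shows "AE \<omega> in M. \<forall>\<^sub>F n in sequentially.
    c' < real (max_local_time X (int_hyperplane a) n \<omega>) / ln (real n)"
proof -
  note q = return_prob_bounds[OF d]
  define m where "m j = nat \<lfloor>c * (real j * ln 2)\<rfloor>" for j :: nat
  have m_le: "real (m j) \<le> c * (real j * ln 2)" for j
    unfolding m_def using c(1) by (intro of_nat_floor) auto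
  define B where "B j = {\<omega> \<in> space M. \<not> m j \<le> max_local_time X (int_hyperplane a) (2 ^ j) \<omega>}" for j
  have B: "B j \<in> events" for j
    unfolding B_def le_max_local_time_iff by (rule path_event_measurable)
  interpret symmetric_steps unit_steps "hyperplane_form a" by (rule symmetric_steps_hyperplane_form[OF a])
  obtain C where C: "0 < C" "\<And>n v. 0 < n \<Longrightarrow>
      1 - lattice.visit_prob (hyperplane_form a) n 0 v \<le> C * real v / sqrt (real n)"
    using few_visits_prob_bound by blast
  have "exp (- 1 / (2 * c)) < exp (ln return_prob)"
    using c by (simp add: field_simps)
  then have "exp (- 1 / (2 * c)) < return_prob" using q by simp
  then have "\<forall>\<^sub>F \<nu> in sequentially. exp (- 1 / (2 * c)) <
      lattice.visit_prob (\<lambda>s. s) \<nu> (0 :: int ^ 'd) 1"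
    by (rule order_tendstoD(1)[OF visit_prob_tendsto_return_prob])
  then obtain \<nu> where \<nu>: "exp (- 1 / (2 * c)) < lattice.visit_prob (\<lambda>s. s) \<nu> (0 :: int ^ 'd) 1"
    by (auto simp: eventually_sequentially)
  define r where "r = lattice.visit_prob (\<lambda>s. s) \<nu> (0 :: int ^ 'd) 1"
  have r0: "0 < r" using \<nu> unfolding r_def by (rule less_trans[rotated]) simp
  have r1: "r < 1" using visit_prob_le_return_prob[of \<nu>] q unfolding r_def by linarith
  define \<beta> where "\<beta> = - (c * ln r)"
  have "ln (exp (- 1 / (2 * c))) < ln r"
    using \<nu> r0 unfolding r_def by (subst ln_less_cancel_iff) auto
  then have "- 1 / (2 * c) < ln r" by simp
  then have \<beta>: "0 < \<beta>" "\<beta> < 1/2" using c r0 r1 by (simp_all add: \<beta>_def field_simps mult_pos_neg)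
  define \<beta>' where "\<beta>' = (\<beta> + 1/2) / 2"
  have \<beta>': "0 < \<beta>'" "\<beta> < \<beta>'" "\<beta>' < 1/2" using \<beta> by (simp_all add: \<beta>'_def)
  define L where "L j = Suc (\<nu> * m j)" for j
  define N where "N j = nat \<lceil>(2 powr \<beta>') ^ j\<rceil>" for j :: nat
  \<comment> \<open>\<open>\<sigma>\<close> is the geometric rate of the event of too few visits to the hyperplane, \<open>\<tau>\<close> that of the
    event that all trials fail.\<close>
  define \<sigma> where "\<sigma> = 2 powr (\<beta>' - 1/2)"
  have \<sigma>: "0 < \<sigma>" "\<sigma> < 1" using \<beta>' unfolding \<sigma>_def by (auto intro!: powr_less_one)
  define \<tau> where "\<tau> = 2 powr (\<beta> - \<beta>')"
  have \<tau>: "0 < \<tau>" "\<tau> < 1" using \<beta>' unfolding \<tau>_def by (auto intro!: powr_less_one)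
  define K where "K = real \<nu> * c + 2"
  have one_le: "1 \<le> (2 powr \<beta>') ^ j" for j
    using \<beta>' by (intro one_le_power ge_one_powr_ge_zero) auto
  have N_le: "real (N j) \<le> 2 * (2 powr \<beta>') ^ j" for j
    unfolding N_def using one_le[of j] by linarith
  have N_ge: "(2 powr \<beta>') ^ j \<le> real (N j)" for j
    unfolding N_def by linarith
  have L_le: "real (Suc (L j)) \<le> K * real (Suc j)" for j
  proof -
    have "real j * ln 2 \<le> real j * 1" using ln_2_less_1 by (intro mult_left_mono) auto
    then have "c * (real j * ln 2) \<le> c * real j" using c by simp
    then have "real (m j) \<le> c * real j" using m_le[of j] by linarith
    then have "real \<nu> * real (m j) \<le> real \<nu> * (c * real j)" by (rule mult_left_mono) simp
    then have "real (Suc (L j)) \<le> real \<nu> * (c * real j) + 2" by (simp add: L_def)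
    also have "\<dots> \<le> K * real (Suc j)" using c by (simp add: K_def algebra_simps)
    finally show ?thesis .
  qed
  have few_visits: "1 - lattice.visit_prob (hyperplane_form a) (2 ^ j) 0 (N j * Suc (L j))
      \<le> 2 * C * K * (real (Suc j) * \<sigma> ^ j)" for j
  proof -
    have s: "sqrt (real (2 ^ j)) = (2 powr (1/2)) ^ j"
      by (simp add: real_sqrt_power powr_half_sqrt[of 2, simplified])
    have "1 - lattice.visit_prob (hyperplane_form a) (2 ^ j) 0 (N j * Suc (L j))
        \<le> C * real (N j * Suc (L j)) / sqrt (real (2 ^ j))" by (rule C) simp
    also have "\<dots> \<le> C * ((2 * (2 powr \<beta>') ^ j) * (K * real (Suc j))) / sqrt (real (2 ^ j))"
      unfolding of_nat_mult using C(1) N_le[of j] L_le[of j]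
      by (intro divide_right_mono mult_left_mono mult_mono) auto
    also have "\<dots> = 2 * C * K * (real (Suc j) * ((2 powr \<beta>') ^ j / (2 powr (1/2)) ^ j))"
      unfolding s by simp
    also have "(2 powr \<beta>') ^ j / (2 powr (1/2)) ^ j = \<sigma> ^ j"
      by (simp only: \<sigma>_def powr_diff power_divide)
    finally show ?thesis .
  qed
  have no_success: "(1 - lattice.visit_prob (\<lambda>s. s) (L j) (0 :: int ^ 'd) (m j)) ^ N j \<le> \<tau> ^ j" for j
  proof -
    let ?p = "lattice.visit_prob (\<lambda>s. s) (L j) (0 :: int ^ 'd) (m j)"
    have "(2 powr (- \<beta>)) ^ j = r powr (c * (real j * ln 2))"
      unfolding power_ln_2_eq[OF r0] by (simp add: \<beta>_def)
    also have "\<dots> \<le> r powr real (m j)" using m_le r0 r1 by (intro powr_mono') auto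
    also have "\<dots> = r ^ m j" using r0 by (simp add: powr_realpow)
    also have "\<dots> \<le> lattice.visit_prob (\<lambda>s. s) (\<nu> * m j) (0 :: int ^ 'd) (m j)"
      unfolding r_def by (rule lattice.power_le_visit_prob)
    also have "\<dots> \<le> ?p" by (rule lattice.visit_prob_mono_time) (simp add: L_def)
    finally have p: "(2 powr (- \<beta>)) ^ j \<le> ?p" .
    have "1 / \<tau> ^ j = (2 powr (- \<beta>)) ^ j * (2 powr \<beta>') ^ j"
    proof -
      have "1 / \<tau> ^ j = (1 / \<tau>) ^ j" by (simp only: power_divide power_one)
      also have "1 / \<tau> = 2 powr (- \<beta>) * 2 powr \<beta>'"
        unfolding \<tau>_def powr_add[symmetric] by (simp add: powr_minus_divide[symmetric])
      finally show ?thesis by (simp only: power_mult_distrib)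
    qed
    also have "\<dots> \<le> ?p * real (N j)"
      using p N_ge[of j] lattice.visit_prob_ge_0 by (intro mult_mono) auto
    finally have pN: "1 / \<tau> ^ j \<le> ?p * real (N j)" .
    have "(1 - ?p) ^ N j \<le> exp (- ?p) ^ N j"
      using exp_ge_add_one_self[of "- ?p"] lattice.visit_prob_le_1 by (intro power_mono) auto
    also have "\<dots> = 1 / exp (?p * real (N j))"
    proof -
      have "exp (- ?p) ^ N j = exp (real (N j) * (- ?p))" by (simp only: exp_of_nat_mult)
      also have "real (N j) * (- ?p) = - (?p * real (N j))" by simp
      finally show ?thesis by (simp only: exp_minus inverse_eq_divide)
    qed
    also have "\<dots> \<le> 1 / (1 / \<tau> ^ j)"
    proof (rule divide_left_mono)
      show "1 / \<tau> ^ j \<le> exp (?p * real (N j))"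
        using pN exp_ge_add_one_self[of "?p * real (N j)"] by linarith
    qed (use \<tau> in auto)
    finally show ?thesis by simp
  qed
  have prob_B: "prob (B j) \<le> 2 * C * K * (real (Suc j) * \<sigma> ^ j) + \<tau> ^ j" for j
    using prob_max_local_time_less[OF a, of "L j" "m j" "2 ^ j" "N j"] few_visits[of j] no_success[of j]
    unfolding B_def by (simp add: L_def)
  have "summable (\<lambda>j. prob (B j))"
  proof (rule summable_comparison_test')
    have "summable (\<lambda>j. real (Suc j) * \<sigma> ^ j)"
      using geometric_deriv_sums[of \<sigma>] \<sigma> by (auto simp: sums_iff)
    then show "summable (\<lambda>j. 2 * C * K * (real (Suc j) * \<sigma> ^ j) + \<tau> ^ j)"
      using \<tau> by (intro summable_add summable_mult summable_geometric) auto
  qed (use prob_B in simp)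
  then have "AE \<omega> in M. \<forall>\<^sub>F j in sequentially. \<omega> \<in> space M - B j"
    using B by (intro borel_cantelli_AE1) (auto simp: emeasure_eq_measure)
  then show ?thesis
  proof (rule AE_mp, intro AE_I2 impI)
    fix \<omega> assume \<omega>: "\<omega> \<in> space M" "\<forall>\<^sub>F j in sequentially. \<omega> \<in> space M - B j"
    show "\<forall>\<^sub>F n in sequentially. c' < real (max_local_time X (int_hyperplane a) n \<omega>) / ln (real n)"
    proof (rule dyadic_lower_interpolation)
      show "mono (\<lambda>n. real (max_local_time X (int_hyperplane a) n \<omega>))"
        by (simp add: mono_def max_local_time_mono)
      show "\<forall>\<^sub>F j in sequentially.
          c * (real j * ln 2) - 1 \<le> real (max_local_time X (int_hyperplane a) (2 ^ j) \<omega>)"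
        using \<omega>(2)
      proof eventually_elim
        case (elim j)
        then have "m j \<le> max_local_time X (int_hyperplane a) (2 ^ j) \<omega>"
          using \<omega>(1) by (auto simp: B_def)
        moreover have "c * (real j * ln 2) - 1 \<le> real (m j)"
          unfolding m_def by linarith
        ultimately show ?case by linarith
      qed
    qed (use c c' in auto)
  qed
qed

lemma max_local_time_limit:
  assumes a: "a \<noteq> 0" and d: "3 \<le> CARD('d)"
  shows "AE \<omega> in M. (\<lambda>n. real (max_local_time X (int_hyperplane a) n \<omega>) / ln (real n))
    \<longlonglongrightarrow> lambda_const M X / 2"
proof -
  let ?f = "\<lambda>n \<omega>. real (max_local_time X (int_hyperplane a) n \<omega>) / ln (real n)"
  define h where "h = lambda_const M X / 2"
  note q = return_prob_bounds[OF d]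
  have ln_q: "ln return_prob < 0" using q by simp
  have h: "0 < h" "h * ln return_prob = - 1/2"
    using ln_q by (simp_all add: h_def lambda_const_eq field_simps)
  have upper: "AE \<omega> in M. \<forall>\<^sub>F n in sequentially. ?f n \<omega> < b" if "h < b" for b
  proof -
    from dense[OF that] obtain c where "h < c" "c < b" by blast
    moreover from this have "c * ln return_prob < - 1/2"
      using mult_strict_right_mono_neg[OF \<open>h < c\<close> ln_q] h(2) by linarith
    ultimately show ?thesis using h by (intro max_local_time_upper[OF a d, of c]) auto
  qed
  have lower: "AE \<omega> in M. \<forall>\<^sub>F n in sequentially. b < ?f n \<omega>" if "b < h" for b
  proof -
    have "max b 0 < h" using that h by simp
    then obtain c where "max b 0 < c" "c < h" using dense by blast
    moreover from this have "- 1/2 < c * ln return_prob"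
      using mult_strict_right_mono_neg[OF \<open>c < h\<close> ln_q] h(2) by linarith
    ultimately show ?thesis by (intro max_local_time_lower[OF a d, of c]) auto
  qed
  have "AE \<omega> in M. \<forall>i. (\<forall>\<^sub>F n in sequentially. ?f n \<omega> < h + 1 / real (Suc i))
      \<and> (\<forall>\<^sub>F n in sequentially. h - 1 / real (Suc i) < ?f n \<omega>)"
    unfolding AE_all_countable by (intro allI AE_conjI upper lower) auto
  then show ?thesis
  proof (rule AE_mp, intro AE_I2 impI)
    fix \<omega>
    assume bounds: "\<forall>i. (\<forall>\<^sub>F n in sequentially. ?f n \<omega> < h + 1 / real (Suc i))
      \<and> (\<forall>\<^sub>F n in sequentially. h - 1 / real (Suc i) < ?f n \<omega>)"
    have "(\<lambda>n. ?f n \<omega>) \<longlonglongrightarrow> h"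
    proof (rule tendstoI)
      fix e :: real assume "0 < e"
      then obtain i where i: "1 / real (Suc i) < e" using nat_approx_posE by blast
      have "\<forall>\<^sub>F n in sequentially. ?f n \<omega> < h + 1 / real (Suc i)"
        "\<forall>\<^sub>F n in sequentially. h - 1 / real (Suc i) < ?f n \<omega>" using bounds by blast+
      then show "\<forall>\<^sub>F n in sequentially. dist (?f n \<omega>) h < e"
        by eventually_elim (use i in \<open>simp add: dist_real_def\<close>)
    qed
    then show "(\<lambda>n. ?f n \<omega>) \<longlonglongrightarrow> lambda_const M X / 2" by (simp add: h_def)
  qed
qed

end

theorem theorem1p4:
  fixes M :: "'a measure" and X :: "nat \<Rightarrow> 'a \<Rightarrow> int ^ 'd" and a :: "int ^ 'd"
  assumes "simple_random_walk M X"
    and "CARD('d) \<ge> 3"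
    and "a \<noteq> 0"
  shows "AE \<omega> in M.
    (\<lambda>n. real (max_local_time X (int_hyperplane a) n \<omega>) / ln (real n))
      \<longlonglongrightarrow> lambda_const M X / 2"
  using simple_random_walk.max_local_time_limit[OF assms(1,3,2)] .

end
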